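(* Let $n\ge 1$, $N=2n+1$, and $c=(1\;2\;\ldots\;N)\in\mathfrak{A}_N$. For every integer $q\ge 1$, the number of multichains $x_1\le_{\mathbf 3}x_2\le_{\mathbf 3}\cdots\le_{\mathbf 3}x_{q-1}$ of elements of the interval $[e,c]_{\mathbf 3}$ (i.e. the value $\mathcal Z(q)$ of the zeta polynomial of $[e,c]_{\mathbf 3}$) equals $$\mathcal{Z}(q)=\frac{q}{q(2n+1)-n}\binom{q(2n+1)-n}{n}.$$
   Context: $\mathfrak{S}_N$ is the symmetric group on $[N]=\{1,\dots,N\}$, $\mathfrak{A}_N$ the alternating group, $e$ the identity; $(1\;2\;\ldots\;N)$ denotes the cycle $1\mapsto2\mapsto\cdots\mapsto N\mapsto1$. For $x\in\mathfrak{A}_N$, $\ell_{\mathbf 3}(x)$ is the minimal number $k$ such that $x$ is a product of $k$ $3$-cycles. The partial order $\le_{\mathbf 3}$ on $\mathfrak{A}_N$ is defined by $x\le_{\mathbf 3}y$ iff $\ell_{\mathbf 3}(y)=\ell_{\mathbf 3}(x)+\ell_{\mathbf 3}(x^{-1}y)$, and $[u,v]_{\mathbf 3}=\{w\in\mathfrak A_N: u\le_{\mathbf 3}w\le_{\mathbf 3}v\}$. The zeta polynomial $\mathcal Z(q)$ of a finite poset counts multichains (weakly increasing sequences) of length $q-1$. *)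

theory Defs
  imports Complex_Main "HOL-Algebra.Sym_Groups"
begin

text \<open>Products are taken in \<^term>\<open>alt_group N\<close>, i.e. they are compositions of functions
  (right factor applied first).\<close>

definition ell3 :: "nat \<Rightarrow> (nat \<Rightarrow> nat) \<Rightarrow> nat" where
  "ell3 N x = (LEAST k. \<exists>ts. length ts = k \<and> set ts \<subseteq> three_cycles N \<and>
      foldr (\<lambda>s t. s \<otimes>\<^bsub>alt_group N\<^esub> t) ts \<one>\<^bsub>alt_group N\<^esub> = x)"

definition le3 :: "nat \<Rightarrow> (nat \<Rightarrow> nat) \<Rightarrow> (nat \<Rightarrow> nat) \<Rightarrow> bool" where
  "le3 N x y \<longleftrightarrow> x \<in> carrier (alt_group N) \<and> y \<in> carrier (alt_group N) \<and>
      ell3 N y = ell3 N x + ell3 N (inv\<^bsub>alt_group N\<^esub> x \<otimes>\<^bsub>alt_group N\<^esub> y)"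

definition interval3 :: "nat \<Rightarrow> (nat \<Rightarrow> nat) \<Rightarrow> (nat \<Rightarrow> nat) \<Rightarrow> (nat \<Rightarrow> nat) set" where
  "interval3 N u v = {w \<in> carrier (alt_group N). le3 N u w \<and> le3 N w v}"

definition multichains :: "('a \<Rightarrow> 'a \<Rightarrow> bool) \<Rightarrow> 'a set \<Rightarrow> nat \<Rightarrow> 'a list set" where
  "multichains R P m = {xs. length xs = m \<and> set xs \<subseteq> P \<and> successively R xs}"

text \<open>Value at \<open>q \<ge> 1\<close> of the zeta polynomial of the finite poset \<open>(P, R)\<close>.\<close>

definition zeta_value :: "('a \<Rightarrow> 'a \<Rightarrow> bool) \<Rightarrow> 'a set \<Rightarrow> nat \<Rightarrow> nat" where
  "zeta_value R P q = card (multichains R P (q - 1))"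

end

theory Submission
  imports Defs "HOL-Combinatorics.Orbits" "HOL-Computational_Algebra.Formal_Power_Series"
begin

text \<open>
  A multichain in \<open>[e, c]\<close> is the same as a factorisation \<open>c = y\<^sub>1 \<cdots> y\<^sub>q\<close> whose \<open>3\<close>-lengths add up
  to that of \<open>c\<close>, and these are the factorisations into permutations with odd cycles only that are
  minimal for the length counted in transpositions.

  Let \<open>A\<^sub>i(z)\<close> be the generating function, by the length \<open>N\<close> of the long cycle, of those
  factorisations whose first \<open>i\<close> factors fix a base point \<open>p\<close>. If the next factor \<open>y\<close> moves \<open>p\<close>,
  write \<open>y = (p a b) y'\<close> with \<open>y'\<close> fixing \<open>a = y\<^sup>-\<^sup>2 p\<close> and \<open>b = y\<^sup>-\<^sup>1 p\<close>. Moving the three-cycle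
  to the front cuts the long cycle into three cycles, and the remaining minimal factorisation splits
  accordingly; hence \<open>A\<^sub>i = A\<^sub>i\<^sub>+\<^sub>1 + A\<^sub>i A\<^sub>1\<^sup>2\<close>, while \<open>A\<^sub>q = z\<close>. With \<open>V = 1 / (1 - A\<^sub>1\<^sup>2)\<close> this
  gives \<open>A\<^sub>i = z V\<^sup>q\<^sup>-\<^sup>i\<close> and \<open>V = 1 + z\<^sup>2 V\<^sup>2\<^sup>q\<^sup>-\<^sup>1\<close>, so the coefficients of \<open>A\<^sub>0 = z V\<^sup>q\<close> are
  Fuss-Catalan (Raney) numbers.
\<close>

section \<open>Cycles of products with transpositions and three-cycles\<close>

text \<open>A product with a three-cycle changes the number of cycles by at most two, and lowers it
  by two exactly when three different cycles are merged; three odd sizes have an odd sum. So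
  \<open>ell3\<close> is at least half the length in transpositions, with equality exactly for
  permutations with odd cycles only, and additivity of \<open>ell3\<close> can be read off from
  cycle counts. The obstacle is the splitting after the cut. It rests on every factor preserving
  each cycle of the product, which is proved by counting components of graphs. The three pieces do
  not play the same part: the piece with the base point keeps the conditions on the first i factors,
  hence A_i, while in each of the other two the factor that lost its three-cycle has to fix a
  prescribed point. A Hurwitz move brings that factor to the front, hence A_1 twice. Orientation
  matters as well: the reversed three-cycle leaves the long cycle whole, and minimality excludes
  it.\<close>

lemma orbit_eq_iff:
  assumes "permutation f"
  shows "orbit f y = orbit f z \<longleftrightarrow> y \<in> orbit f z"
  by (metis assms orbit_cyclic_eq3 cyclic_on_orbit' permutation_self_in_orbit)

lemma orbit_disjoint:
  assumes "permutation f" "orbit f x \<noteq> orbit f y"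
  shows "orbit f x \<inter> orbit f y = {}"
  using assms by (metis disjoint_iff orbit_eq_iff)

text \<open>The product follows \<open>f\<close> except at the two steps that enter \<open>x\<close>
  and \<open>a\<close>, which are exchanged. Hence the walk runs once round the cycle of
  \<open>x\<close>, then once round that of \<open>a\<close>, and no other cycle is touched.\<close>

lemma orbit_transpose_comp_merge:
  assumes f: "permutation f" and ne: "orbit f x \<noteq> orbit f a"
  shows "orbit (transpose x a \<circ> f) z =
    (if z \<in> orbit f x \<union> orbit f a then orbit f x \<union> orbit f a else orbit f z)"
proof -
  define g where "g = transpose x a \<circ> f"
  have g: "permutation g"
    unfolding g_def using f by (intro permutation_compose permutation_swap_id)
  have xa: "x \<notin> orbit f a" "a \<notin> orbit f x"
    using ne by (metis f orbit_eq_iff)+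
  \<comment> \<open>Starting at \<open>u\<close>, both maps agree until \<open>f\<close> returns to
    \<open>u\<close>; there nothing is left to show, as \<open>u\<close> lies in its own
    orbit.\<close>
  have half: "orbit f u \<subseteq> orbit g u" if "{u, v} = {x, a}" for u v
  proof
    fix s assume "s \<in> orbit f u"
    then show "s \<in> orbit g u"
    proof (induction rule: orbit.induct)
      case base
      show ?case
      proof (cases "f u = u")
        case False
        have "f u \<noteq> v" using that xa orbit.base[of f u] by (auto simp: doubleton_eq_iff)
        then have "g u = f u"
          using that False by (auto simp: g_def doubleton_eq_iff)
        then show ?thesis by (metis orbit.base)
      qed (simp add: g permutation_self_in_orbit)
    next
      case (step s)
      show ?case
      proof (cases "f s = u")
        case False
        have "f s \<noteq> v" using that xa orbit.step[OF step(1)] by (auto simp: doubleton_eq_iff)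
        then have "g s = f s"
          using that False by (auto simp: g_def doubleton_eq_iff)
        then show ?thesis by (metis orbit.step step.IH)
      qed (simp add: g permutation_self_in_orbit)
    qed
  qed
  have "inv' f a \<in> orbit f a"
    by (metis assms(1) orbit.base orbit_inv_eq)
  then have "inv' f a \<in> orbit g a" using half[of a x] by auto
  moreover have "g (inv' f a) = x"
    using f by (simp add: g_def permutation_inverse_works(2) permutation_bijective bij_is_surj surj_f_inv_f)
  ultimately have "x \<in> orbit g a" by (metis orbit.step)
  then have eq: "orbit g x = orbit g a" by (simp add: orbit_eq_iff g)
  have closed: "s \<in> orbit f x \<union> orbit f a" if "s \<in> orbit g x" for s
    using that
  proof (induction rule: orbit.induct)
    case base
    then show ?case
      using permutation_self_in_orbit[OF f] orbit.base[of f x]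
      by (auto simp: g_def transpose_def)
  next
    case (step s)
    then show ?case
      using permutation_self_in_orbit[OF f] orbit.step[of s f]
      by (auto simp: g_def transpose_def)
  qed
  have un: "orbit g x = orbit f x \<union> orbit f a"
    using closed half[of x a] half[of a x] eq by blast
  show ?thesis
  proof (cases "z \<in> orbit f x \<union> orbit f a")
    case True
    then show ?thesis using un orbit_eq_iff[OF g, of z x] by (auto simp: g_def)
  next
    case False
    have "orbit g z = orbit f z"
    proof (rule orbit_cong)
      show "z \<in> orbit f z" using f by (rule permutation_self_in_orbit)
      fix s assume "s \<in> orbit f z"
      then have fs: "f s \<in> orbit f z" by (rule orbit.step)
      have "f s \<noteq> x" "f s \<noteq> a"
        using False fs orbit_swap[OF permutation_self_in_orbit[OF f] fs] by auto
      then show "g s = f s" by (simp add: g_def)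
    qed
    then show ?thesis using False by (simp add: g_def)
  qed
qed

text \<open>For a permutation of a finite \<open>S\<close> this is the least number of
  transpositions with product \<open>f\<close>, expressed by the number of cycles; fixed points
  count as cycles.\<close>

definition abs_length :: "'a set \<Rightarrow> ('a \<Rightarrow> 'a) \<Rightarrow> nat" where
  "abs_length S f = card S - card (orbit f ` S)"

text \<open>No carrier set is mentioned: points outside the support form cycles of size one. An
  infinite orbit is excluded, since \<open>card\<close> gives it the even value 0.\<close>

definition odd_cycles :: "('a \<Rightarrow> 'a) \<Rightarrow> bool" where
  "odd_cycles f \<longleftrightarrow> (\<forall>z. odd (card (orbit f z)))"

lemma card_orbits_add_abs_length:
  "finite S \<Longrightarrow> card (orbit f ` S) + abs_length S f = card S"
  by (simp add: abs_length_def card_image_le)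

lemma permutes_imp_permutation: "f permutes S \<Longrightarrow> finite S \<Longrightarrow> permutation f"
  by (auto simp: permutation_permutes)

lemma abs_length_transpose_comp_merge:
  assumes S: "finite S" and f: "f permutes S" and x: "x \<in> S" and a: "a \<in> S"
    and ne: "orbit f x \<noteq> orbit f a"
  shows "abs_length S (transpose x a \<circ> f) = Suc (abs_length S f)"
proof -
  have pf: "permutation f" using f S by (rule permutes_imp_permutation)
  let ?U = "orbit f x \<union> orbit f a"
  have self: "z \<in> orbit f z" for z using pf by (rule permutation_self_in_orbit)
  have "orbit (transpose x a \<circ> f) ` S = insert ?U (orbit f ` S - {orbit f x, orbit f a})"
  proof (intro equalityI subsetI)
    fix A assume "A \<in> orbit (transpose x a \<circ> f) ` S"
    then obtain z where "z \<in> S" "A = orbit (transpose x a \<circ> f) z" by auto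
    then show "A \<in> insert ?U (orbit f ` S - {orbit f x, orbit f a})"
      unfolding orbit_transpose_comp_merge[OF pf ne] using self[of z] by auto
  next
    fix A assume A: "A \<in> insert ?U (orbit f ` S - {orbit f x, orbit f a})"
    show "A \<in> orbit (transpose x a \<circ> f) ` S"
    proof (cases "A = ?U")
      case True
      then have "A = orbit (transpose x a \<circ> f) x"
        unfolding orbit_transpose_comp_merge[OF pf ne] using self[of x] by auto
      then show ?thesis using x by auto
    next
      case False
      then obtain z where z: "z \<in> S" "A = orbit f z" "orbit f z \<noteq> orbit f x" "orbit f z \<noteq> orbit f a"
        using A by auto
      then have "A = orbit (transpose x a \<circ> f) z"
        unfolding orbit_transpose_comp_merge[OF pf ne] using orbit_eq_iff[OF pf] by auto
      then show ?thesis using z by auto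
    qed
  qed
  moreover have "?U \<notin> orbit f ` S"
  proof
    assume "?U \<in> orbit f ` S"
    then obtain z where "?U = orbit f z" by auto
    then have "x \<in> orbit f z" "a \<in> orbit f z" using self by blast+
    then show False using ne orbit_eq_iff[OF pf] by blast
  qed
  ultimately have "card (orbit (transpose x a \<circ> f) ` S) = Suc (card (orbit f ` S - {orbit f x, orbit f a}))"
    using S by simp
  also have "card (orbit f ` S - {orbit f x, orbit f a}) = card (orbit f ` S) - 2"
    using x a ne by (subst card_Diff_subset) auto
  finally have "card (orbit (transpose x a \<circ> f) ` S) = Suc (card (orbit f ` S) - 2)" .
  \<comment> \<open>There are at least two cycles and at most \<open>card S\<close> of them, so
    neither truncated subtraction loses anything.\<close>
  moreover have "card {orbit f x, orbit f a} \<le> card (orbit f ` S)"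
    using x a S by (intro card_mono) auto
  moreover have "card (orbit f ` S) \<le> card S" using S by (rule card_image_le)
  ultimately show ?thesis using ne by (simp add: abs_length_def)
qed

text \<open>For distinct arguments this is the cycle \<open>x\<close> \<mapsto> \<open>a\<close>
  \<mapsto> \<open>b\<close> \<mapsto> \<open>x\<close>. Written with two transpositions, so that
  its effect on cycles follows by merging twice.\<close>

definition cyc3 :: "'a \<Rightarrow> 'a \<Rightarrow> 'a \<Rightarrow> 'a \<Rightarrow> 'a" where
  "cyc3 x a b = transpose x b \<circ> transpose x a"

lemma cyc3_merge:
  assumes S: "finite S" and f: "f permutes S" and x: "x \<in> S" and a: "a \<in> S" and b: "b \<in> S"
    and ne: "orbit f x \<noteq> orbit f a" "orbit f x \<noteq> orbit f b" "orbit f a \<noteq> orbit f b"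
  shows abs_length_cyc3_comp: "abs_length S (cyc3 x a b \<circ> f) = abs_length S f + 2"
    and orbit_cyc3_comp: "orbit (cyc3 x a b \<circ> f) z =
      (if z \<in> orbit f x \<union> orbit f a \<union> orbit f b then orbit f x \<union> orbit f a \<union> orbit f b
       else orbit f z)"
proof -
  let ?g = "transpose x a \<circ> f"
  have pf: "permutation f" using f S by (rule permutes_imp_permutation)
  have g: "?g permutes S" using f x a by (intro permutes_compose permutes_swap_id)
  have pg: "permutation ?g" using g S by (rule permutes_imp_permutation)
  have self: "z \<in> orbit f z" for z using pf by (rule permutation_self_in_orbit)
  have ox: "orbit ?g x = orbit f x \<union> orbit f a"
    using self[of x] by (simp add: orbit_transpose_comp_merge[OF pf ne(1)])
  have "b \<notin> orbit f x \<union> orbit f a" using ne by (metis Un_iff pf orbit_eq_iff)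
  then have ob: "orbit ?g b = orbit f b"
    by (simp add: orbit_transpose_comp_merge[OF pf ne(1)])
  have ne': "orbit ?g x \<noteq> orbit ?g b"
    using ob ox \<open>b \<notin> orbit f x \<union> orbit f a\<close> self[of b] by auto
  have eq: "cyc3 x a b \<circ> f = transpose x b \<circ> ?g" by (simp add: cyc3_def comp_assoc)
  show "abs_length S (cyc3 x a b \<circ> f) = abs_length S f + 2"
    unfolding eq using abs_length_transpose_comp_merge[OF S g x b ne']
      abs_length_transpose_comp_merge[OF S f x a ne(1)] by simp
  show "orbit (cyc3 x a b \<circ> f) z =
      (if z \<in> orbit f x \<union> orbit f a \<union> orbit f b then orbit f x \<union> orbit f a \<union> orbit f b
       else orbit f z)"
    unfolding eq orbit_transpose_comp_merge[OF pg ne'] ox ob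
    by (simp add: orbit_transpose_comp_merge[OF pf ne(1)])
qed

text \<open>Three disjoint cycles of odd size merge into one, and a sum of three odd numbers is
  odd.\<close>

lemma odd_cycles_cyc3_comp:
  assumes S: "finite S" and f: "f permutes S" and x: "x \<in> S" and a: "a \<in> S" and b: "b \<in> S"
    and ne: "orbit f x \<noteq> orbit f a" "orbit f x \<noteq> orbit f b" "orbit f a \<noteq> orbit f b"
    and odd: "odd_cycles f"
  shows "odd_cycles (cyc3 x a b \<circ> f)"
proof -
  have pf: "permutation f" using f S by (rule permutes_imp_permutation)
  have fin: "finite (orbit f z)" for z using pf by (simp add: finite_orbit permutation_self_in_orbit)
  have dis: "orbit f x \<inter> orbit f a = {}" "(orbit f x \<union> orbit f a) \<inter> orbit f b = {}"
    using orbit_disjoint[OF pf] ne by (simp_all add: Int_Un_distrib2)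
  have "odd (card (orbit f x \<union> orbit f a \<union> orbit f b))"
    using odd dis by (simp add: card_Un_disjoint fin odd_cycles_def)
  then show ?thesis
    using odd by (simp add: odd_cycles_def orbit_cyc3_comp[OF S f x a b ne])
qed

section \<open>Inserting two fixed points into a cycle\<close>

lemma permutes_cyc3: "x \<in> S \<Longrightarrow> a \<in> S \<Longrightarrow> b \<in> S \<Longrightarrow> cyc3 x a b permutes S"
  unfolding cyc3_def by (intro permutes_compose permutes_swap_id)

lemma cyc3_apply:
  assumes "x \<noteq> a" "x \<noteq> b" "a \<noteq> b"
  shows "cyc3 x a b v = (if v = x then a else if v = a then b else if v = b then x else v)"
  using assms by (simp add: cyc3_def transpose_def)

lemma cyc3_inverse:
  assumes "x \<noteq> a" "x \<noteq> b" "a \<noteq> b"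
  shows "cyc3 x a b \<circ> cyc3 x b a = id"
  using assms by (intro ext) (simp add: cyc3_apply)

lemma cyc3_square:
  assumes "x \<noteq> a" "x \<noteq> b" "a \<noteq> b"
  shows "cyc3 x a b \<circ> cyc3 x a b = cyc3 x b a"
  using assms by (intro ext) (simp add: cyc3_apply)

lemma orbits_distinct_if_fixed:
  assumes "permutation f" "f a = a" "f b = b" "x \<noteq> a" "x \<noteq> b" "a \<noteq> b"
  shows "orbit f x \<noteq> orbit f a" "orbit f x \<noteq> orbit f b" "orbit f a \<noteq> orbit f b"
proof -
  have "orbit f a = {a}" "orbit f b = {b}"
    using assms by (simp_all add: orbit_eq_singleton_iff)
  then show "orbit f x \<noteq> orbit f a" "orbit f x \<noteq> orbit f b" "orbit f a \<noteq> orbit f b"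
    using assms permutation_self_in_orbit[OF assms(1), of x] by auto
qed

text \<open>The cycle of \<open>x\<close> grows by exactly the two points \<open>a\<close> and
  \<open>b\<close>, and every other cycle is unchanged. Both directions serve: one to take a
  three-cycle off a factor, one to put it back.\<close>

lemma odd_cycles_cyc3_comp_fixed_iff:
  assumes S: "finite S" and f: "f permutes S" and x: "x \<in> S" and a: "a \<in> S" and b: "b \<in> S"
    and fixed: "f a = a" "f b = b" and dist: "x \<noteq> a" "x \<noteq> b" "a \<noteq> b"
  shows "odd_cycles (cyc3 x a b \<circ> f) \<longleftrightarrow> odd_cycles f"
proof
  have pf: "permutation f" using f S by (rule permutes_imp_permutation)
  note ne = orbits_distinct_if_fixed[OF pf fixed dist]
  show "odd_cycles (cyc3 x a b \<circ> f)" if "odd_cycles f"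
    using odd_cycles_cyc3_comp[OF S f x a b ne that] .
  assume odd: "odd_cycles (cyc3 x a b \<circ> f)"
  have sing: "orbit f a = {a}" "orbit f b = {b}"
    using fixed by (simp_all add: orbit_eq_singleton_iff)
  have nin: "a \<notin> orbit f x" "b \<notin> orbit f x" using ne by (metis pf orbit_eq_iff)+
  have fin: "finite (orbit f x)" using pf by (simp add: finite_orbit permutation_self_in_orbit)
  have self: "z \<in> orbit f z" for z using pf by (rule permutation_self_in_orbit)
  have "card (orbit (cyc3 x a b \<circ> f) x) = Suc (Suc (card (orbit f x)))"
    using nin fin dist self[of x] by (simp add: orbit_cyc3_comp[OF S f x a b ne] sing)
  then have ox: "odd (card (orbit f x))"
    using odd by (metis even_Suc odd_cycles_def)
  show "odd_cycles f"
    unfolding odd_cycles_def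
  proof
    fix z
    consider "z \<in> orbit f x" | "z = a" | "z = b" | "z \<notin> orbit f x \<union> orbit f a \<union> orbit f b"
      using sing by auto
    then show "odd (card (orbit f z))"
    proof cases
      case 1
      then have "orbit f z = orbit f x" using orbit_eq_iff[OF pf] by simp
      then show ?thesis using ox by simp
    next
      case 4
      then have "orbit (cyc3 x a b \<circ> f) z = orbit f z" by (simp add: orbit_cyc3_comp[OF S f x a b ne])
      then show ?thesis using odd by (metis odd_cycles_def)
    qed (simp_all add: sing)
  qed
qed

section \<open>Minimal factorisations preserve the cycles of the product\<close>

definition comp_list :: "('a \<Rightarrow> 'a) list \<Rightarrow> 'a \<Rightarrow> 'a" where
  "comp_list ys = foldr (\<circ>) ys id"

lemma comp_list_simps [simp]:
  "comp_list [] = id"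
  "comp_list (y # ys) = y \<circ> comp_list ys"
  "comp_list (ys @ zs) = comp_list ys \<circ> comp_list zs"
proof -
  show "comp_list [] = id" and *: "\<And>y ys. comp_list (y # ys) = y \<circ> comp_list ys"
    by (simp_all add: comp_list_def)
  show "comp_list (ys @ zs) = comp_list ys \<circ> comp_list zs"
    by (induction ys) (simp_all add: comp_list_def comp_assoc)
qed

lemma comp_list_permutes:
  "(\<And>y. y \<in> set ys \<Longrightarrow> y permutes S) \<Longrightarrow> comp_list ys permutes S"
  by (induction ys) (auto intro: permutes_compose permutes_id)

text \<open>\<open>h\<close> stands for the map to the connected components of the graph with edge
  set \<open>E\<close>: inserting an edge identifies two labels and so costs at most one of
  them.\<close>

lemma labelling_of_edges:
  assumes "finite E" "finite S"
  shows "\<exists>h :: 'a \<Rightarrow> 'a. (\<forall>(a, b) \<in> E. h a = h b) \<and> card S \<le> card (h ` S) + card E"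
  using assms(1)
proof induction
  case empty
  show ?case by (intro exI[of _ id]) simp
next
  case (insert e E)
  obtain a b where e: "e = (a, b)" by (cases e)
  obtain h :: "'a \<Rightarrow> 'a" where h: "\<And>a b. (a, b) \<in> E \<Longrightarrow> h a = h b" "card S \<le> card (h ` S) + card E"
    using insert.IH by auto
  define k where "k z = (if h z = h a then h b else h z)" for z
  have "h ` S \<subseteq> insert (h a) (k ` S)" by (auto simp: k_def)
  then have "card (h ` S) \<le> card (insert (h a) (k ` S))"
    using assms by (intro card_mono) auto
  also have "\<dots> \<le> Suc (card (k ` S))" using card_insert_le_m1 by (simp add: card_insert_if assms)
  finally have "card S \<le> card (k ` S) + card (insert e E)"
    using h(2) insert.hyps by simp
  moreover have "\<forall>(a, b) \<in> insert e E. k a = k b"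
    using h(1) by (auto simp: k_def e)
  ultimately show ?case by blast
qed

text \<open>Each cycle is spanned by a star centred at a chosen representative. A cycle of size k
  contributes k - 1 edges, and these add up to \<open>abs_length\<close>.\<close>

lemma spanning_edges_of_permutation:
  assumes S: "finite S" and f: "f permutes S"
  shows "\<exists>E. finite E \<and> card E = abs_length S f \<and>
    (\<forall>h :: 'a \<Rightarrow> 'b. (\<forall>(a, b) \<in> E. h a = h b) \<longrightarrow> (\<forall>z\<in>S. h (f z) = h z))"
proof -
  have pf: "permutation f" using f S by (rule permutes_imp_permutation)
  define r where "r Q = (SOME s. s \<in> Q)" for Q :: "'a set"
  have r: "r (orbit f z) \<in> orbit f z" for z
    unfolding r_def using permutation_self_in_orbit[OF pf, of z] by (rule someI)
  have r_orb: "orbit f (r (orbit f z)) = orbit f z" for z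
    using r orbit_eq_iff[OF pf] by blast
  define R where "R = r ` orbit f ` S"
  have "inj_on r (orbit f ` S)"
    by (rule inj_on_inverseI[where g = "orbit f"]) (auto simp: r_orb)
  then have cR: "card R = card (orbit f ` S)" by (simp add: R_def card_image)
  have RS: "R \<subseteq> S" using r permutes_orbit_subset[OF f] by (auto simp: R_def)
  define E where "E = (\<lambda>z. (z, r (orbit f z))) ` (S - R)"
  have "card E = card (S - R)" unfolding E_def by (intro card_image inj_onI) auto
  also have "\<dots> = abs_length S f"
    using S RS by (simp add: card_Diff_subset finite_subset cR abs_length_def)
  finally have "card E = abs_length S f" .
  moreover have "finite E" using S by (simp add: E_def)
  moreover have "h (f z) = h z" if h: "\<forall>(a, b) \<in> E. h a = h b" and z: "z \<in> S" for h :: "'a \<Rightarrow> 'b" and z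
  proof -
    have rep: "h s = h (r (orbit f s))" if "s \<in> S" for s
    proof (cases "s \<in> R")
      case True
      then obtain s' where "s = r (orbit f s')" by (auto simp: R_def)
      then show ?thesis using r_orb by simp
    next
      case False
      then show ?thesis using that h by (auto simp: E_def)
    qed
    have "f z \<in> S" using f z by (simp add: permutes_in_image)
    then show ?thesis
      using rep[OF z] rep[of "f z"] permutation_orbit_step[OF pf] by simp
  qed
  ultimately show ?thesis by blast
qed

text \<open>Join the spanning edges of all factors to \<open>E\<close> and label the components. The
  extra edges \<open>E\<close> force further identifications at a controlled cost.\<close>

lemma invariant_labelling:
  assumes S: "finite S" and E: "finite E" and ys: "\<And>y. y \<in> set ys \<Longrightarrow> y permutes S"
  shows "\<exists>h :: 'a \<Rightarrow> 'a. (\<forall>(a, b) \<in> E. h a = h b) \<and> (\<forall>y\<in>set ys. \<forall>z\<in>S. h (y z) = h z) \<and>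
    card S \<le> card (h ` S) + (card E + sum_list (map (abs_length S) ys))"
proof -
  have "\<forall>y\<in>set ys. y permutes S" using ys by blast
  then have "\<exists>F. finite F \<and> card F \<le> sum_list (map (abs_length S) ys) \<and>
    (\<forall>h :: 'a \<Rightarrow> 'a. (\<forall>(a, b) \<in> F. h a = h b) \<longrightarrow> (\<forall>y\<in>set ys. \<forall>z\<in>S. h (y z) = h z))"
  proof (induction ys)
    case (Cons y ys)
    have prems: "\<forall>y\<in>set ys. y permutes S" "y permutes S" using Cons.prems by simp_all
    obtain F where F: "finite F" "card F \<le> sum_list (map (abs_length S) ys)"
      "\<forall>h :: 'a \<Rightarrow> 'a. (\<forall>(a, b) \<in> F. h a = h b) \<longrightarrow> (\<forall>y\<in>set ys. \<forall>z\<in>S. h (y z) = h z)"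
      using Cons.IH[OF prems(1)] by (elim exE conjE) (rule that)
    obtain G where G: "finite G" "card G = abs_length S y"
      "\<forall>h :: 'a \<Rightarrow> 'a. (\<forall>(a, b) \<in> G. h a = h b) \<longrightarrow> (\<forall>z\<in>S. h (y z) = h z)"
      using spanning_edges_of_permutation[where 'b = 'a, OF S prems(2)]
      by (elim exE conjE) (rule that)
    have 1: "card (F \<union> G) \<le> sum_list (map (abs_length S) (y # ys))"
      using card_Un_le[of F G] F(2) G(2) by simp
    have 2: "\<forall>y'\<in>set (y # ys). \<forall>z\<in>S. h (y' z) = h z"
      if "\<forall>(a, b) \<in> F \<union> G. h a = h b" for h :: "'a \<Rightarrow> 'a"
    proof -
      have "\<forall>(a, b) \<in> F. h a = h b" "\<forall>(a, b) \<in> G. h a = h b" using that by blast+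
      then show ?thesis using F(3) G(3) by simp
    qed
    show ?case
      using F(1) G(1) 1 2 by (intro exI[of _ "F \<union> G"] conjI allI impI finite_UnI) assumption+
  qed auto
  then obtain F where F: "finite F" "card F \<le> sum_list (map (abs_length S) ys)"
      "\<forall>h :: 'a \<Rightarrow> 'a. (\<forall>(a, b) \<in> F. h a = h b) \<longrightarrow> (\<forall>y\<in>set ys. \<forall>z\<in>S. h (y z) = h z)"
    by (elim exE conjE) (rule that)
  obtain h :: "'a \<Rightarrow> 'a" where h: "\<forall>(a, b) \<in> E \<union> F. h a = h b" "card S \<le> card (h ` S) + card (E \<union> F)"
    using labelling_of_edges[of "E \<union> F" S] E F(1) S by auto
  have "card S \<le> card (h ` S) + (card E + sum_list (map (abs_length S) ys))"
    using h(2) card_Un_le[of E F] F(2) by simp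
  moreover have "\<forall>y\<in>set ys. \<forall>z\<in>S. h (y z) = h z"
  proof -
    have "\<forall>(a, b) \<in> F. h a = h b" using h(1) by blast
    then show ?thesis using F(3) by blast
  qed
  moreover have "\<forall>(a, b) \<in> E. h a = h b" using h(1) by blast
  ultimately show ?thesis by blast
qed

text \<open>\<open>h\<close> factors through the set of cycles, so there are at most as many labels
  as cycles. If the numbers agree, the induced map is injective and labels separate cycles.\<close>

lemma invariant_labelling_orbits:
  assumes S: "finite S" and f: "f permutes S" and h: "\<And>z. z \<in> S \<Longrightarrow> h (f z) = h z"
  shows card_invariant_labelling_le: "card (h ` S) \<le> card (orbit f ` S)"
    and orbit_eq_if_card_labelling: "card (orbit f ` S) \<le> card (h ` S) \<Longrightarrow>
      y \<in> S \<Longrightarrow> z \<in> S \<Longrightarrow> h y = h z \<Longrightarrow> orbit f y = orbit f z"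
proof -
  have pf: "permutation f" using f S by (rule permutes_imp_permutation)
  have const: "h y = h z" if "y \<in> orbit f z" "z \<in> S" for y z
    using that
  proof (induction rule: orbit.induct)
    case (step y)
    then have "y \<in> S" using permutes_orbit_subset[OF f] by blast
    then show ?case using h step by simp
  qed (simp add: h)
  define g where "g Q = h (SOME s. s \<in> Q)" for Q
  have g: "g (orbit f z) = h z" if "z \<in> S" for z
    unfolding g_def using permutation_self_in_orbit[OF pf, of z] that
    by (intro const) (rule someI)
  have im: "h ` S = g ` (orbit f ` S)" by (auto simp: g image_image)
  show le: "card (h ` S) \<le> card (orbit f ` S)"
    unfolding im using S by (intro card_image_le) simp
  show "orbit f y = orbit f z"
    if "card (orbit f ` S) \<le> card (h ` S)" "y \<in> S" "z \<in> S" "h y = h z"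
  proof -
    have "inj_on g (orbit f ` S)"
      using that(1) le S by (intro eq_card_imp_inj_on) (simp_all flip: im)
    then show ?thesis using that g by (metis imageI inj_onD)
  qed
qed

lemma comp_list_invariant:
  assumes "\<And>y. y \<in> set ys \<Longrightarrow> y permutes S" "\<forall>y\<in>set ys. \<forall>z\<in>S. h (y z) = h z" "z \<in> S"
  shows "h (comp_list ys z) = h z"
  using assms
proof (induction ys)
  case (Cons y ys)
  have "comp_list ys z \<in> S"
    using comp_list_permutes[of ys S] Cons.prems by (simp add: permutes_in_image)
  then show ?case using Cons by simp
qed simp

text \<open>A labelling invariant under every factor is invariant under the product, so the product
  has at least as many cycles as there are labels.\<close>

lemma abs_length_comp_list_le:
  assumes S: "finite S" and ys: "\<And>y. y \<in> set ys \<Longrightarrow> y permutes S"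
  shows "abs_length S (comp_list ys) \<le> sum_list (map (abs_length S) ys)"
proof -
  obtain h :: "'a \<Rightarrow> 'a" where h: "\<forall>y\<in>set ys. \<forall>z\<in>S. h (y z) = h z"
    "card S \<le> card (h ` S) + sum_list (map (abs_length S) ys)"
    using invariant_labelling[OF S, of "{}" ys] ys by auto
  have "card (h ` S) \<le> card (orbit (comp_list ys) ` S)"
    using comp_list_invariant[of ys S h] h(1) ys
    by (intro card_invariant_labelling_le[OF S] comp_list_permutes) auto
  then show ?thesis using h(2) by (simp add: abs_length_def)
qed

text \<open>In a minimal factorisation every factor preserves each cycle of the product: the cycles of
  the factors are spanned by as many edges as a spanning forest of the cycles of the product has,
  so the connected components they generate cannot be larger than those cycles.\<close>

lemma minimal_factor_in_orbit:
  assumes S: "finite S" and ys: "\<And>y. y \<in> set ys \<Longrightarrow> y permutes S"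
    and min: "sum_list (map (abs_length S) ys) \<le> abs_length S (comp_list ys)"
    and y: "y \<in> set ys" and z: "z \<in> S"
  shows "y z \<in> orbit (comp_list ys) z"
proof -
  let ?w = "comp_list ys"
  have w: "?w permutes S" using ys by (rule comp_list_permutes)
  obtain h :: "'a \<Rightarrow> 'a" where h: "\<forall>y\<in>set ys. \<forall>z\<in>S. h (y z) = h z"
    "card S \<le> card (h ` S) + sum_list (map (abs_length S) ys)"
    using invariant_labelling[OF S, of "{}" ys] ys by auto
  have "card (orbit ?w ` S) \<le> card (h ` S)"
    using h(2) min card_orbits_add_abs_length[OF S, of ?w] by linarith
  moreover have "y z \<in> S" using ys[OF y] z by (simp add: permutes_in_image)
  ultimately have "orbit ?w (y z) = orbit ?w z"
    using h(1) y z comp_list_invariant[of ys S h] ys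
    by (intro orbit_eq_if_card_labelling[OF S w, where h = h]) auto
  then show ?thesis using w S by (simp add: orbit_eq_iff permutes_imp_permutation)
qed

text \<open>Converse of \<open>abs_length_cyc3_comp\<close>. If two of the three points shared a
  cycle of \<open>f\<close>, a single further edge would connect all three, and the product would
  exceed \<open>f\<close> in length by at most one.\<close>

lemma orbits_distinct_if_cyc3_length:
  assumes S: "finite S" and f: "f permutes S" and x: "x \<in> S" and a: "a \<in> S" and b: "b \<in> S"
    and len: "abs_length S (cyc3 x a b \<circ> f) = abs_length S f + 2"
  shows "orbit f x \<noteq> orbit f a" "orbit f x \<noteq> orbit f b" "orbit f a \<noteq> orbit f b"
proof -
  have pf: "permutation f" using f S by (rule permutes_imp_permutation)
  \<comment> \<open>\<open>u\<close> and \<open>v\<close> share a cycle, \<open>(p, s)\<close> is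
    the one extra edge, and \<open>link\<close> says that these two identifications tie
    \<open>x\<close>, \<open>a\<close> and \<open>b\<close> together.\<close>
  have False if same: "orbit f u = orbit f v"
    and link: "\<And>h :: 'a \<Rightarrow> 'a. h u = h v \<Longrightarrow> h p = h s \<Longrightarrow> h x = h a \<and> h x = h b"
    and uv: "u \<in> S" "v \<in> S" for u v p s
  proof -
    obtain h :: "'a \<Rightarrow> 'a" where h: "h p = h s" "\<forall>z\<in>S. h (f z) = h z"
      "card S \<le> card (h ` S) + (1 + abs_length S f)"
      using invariant_labelling[OF S, of "{(p, s)}" "[f]"] f by auto
    have "h z = h v" if "z \<in> orbit f v" for z
      using that
    proof (induction rule: orbit.induct)
      case (step z)
      then have "z \<in> S" using permutes_orbit_subset[OF f uv(2)] by blast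
      then show ?case using h step by simp
    qed (use h uv in simp)
    then have "h u = h v" using same permutation_self_in_orbit[OF pf, of u] by simp
    from link[of h, OF this h(1)] have eq: "h x = h a" "h x = h b" by (rule conjunct1, rule conjunct2)
    have "h (cyc3 x a b v) = h v" for v
    proof -
      have "cyc3 x a b v = v \<or> v \<in> {x, a, b} \<and> cyc3 x a b v \<in> {x, a, b}"
        by (simp add: cyc3_def transpose_def)
      then show ?thesis using eq by (metis insertE singletonD)
    qed
    then have inv: "h ((cyc3 x a b \<circ> f) z) = h z" if "z \<in> S" for z using h(2) that by simp
    have "card (h ` S) \<le> card (orbit (cyc3 x a b \<circ> f) ` S)"
      by (rule card_invariant_labelling_le[OF S permutes_compose[OF f permutes_cyc3[OF x a b]]])
        (rule inv)
    then show False
      using h(3) len card_orbits_add_abs_length[OF S, of "cyc3 x a b \<circ> f"] by linarith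
  qed note * = this
  show "orbit f x \<noteq> orbit f a" using *[of x a x b] x a by auto
  show "orbit f x \<noteq> orbit f b" using *[of x b x a] x b by auto
  show "orbit f a \<noteq> orbit f b" using *[of a b x a] a b by auto
qed

section \<open>Conjugation and Hurwitz moves\<close>

text \<open>Identity factors are allowed; they correspond to repetitions in a multichain. Additivity
  of the length in transpositions, together with \<open>odd_cycles\<close>, encodes additivity of
  \<open>ell3\<close>.\<close>

definition min_fact :: "nat \<Rightarrow> 'a set \<Rightarrow> ('a \<Rightarrow> 'a) \<Rightarrow> ('a \<Rightarrow> 'a) list set" where
  "min_fact q S w = {ys. length ys = q \<and> (\<forall>y\<in>set ys. y permutes S \<and> odd_cycles y) \<and>
     comp_list ys = w \<and> sum_list (map (abs_length S) ys) = abs_length S w}"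

lemma finite_min_fact: "finite S \<Longrightarrow> finite (min_fact q S w)"
  by (rule finite_subset[OF _ finite_lists_length_eq[OF finite_permutations, of S q]])
    (auto simp: min_fact_def)

section \<open>Transport of factorisations by conjugation\<close>

definition conj_by :: "('a \<Rightarrow> 'a) \<Rightarrow> ('a \<Rightarrow> 'a) \<Rightarrow> 'a \<Rightarrow> 'a" where
  "conj_by h y = h \<circ> y \<circ> inv' h"

lemma conj_by_apply: "bij h \<Longrightarrow> conj_by h y (h z) = h (y z)"
  by (simp add: conj_by_def bij_is_inj)

lemma conj_by_comp: "bij h \<Longrightarrow> conj_by h (f \<circ> g) = conj_by h f \<circ> conj_by h g"
  by (simp add: conj_by_def fun_eq_iff bij_is_inj)

lemma conj_by_id: "bij h \<Longrightarrow> conj_by h id = id"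
  by (simp add: conj_by_def fun_eq_iff bij_is_surj surj_f_inv_f)

lemma conj_by_inv: "bij h \<Longrightarrow> conj_by (inv' h) (conj_by h y) = y"
  by (simp add: conj_by_def fun_eq_iff bij_is_inj inv_inv_eq)

lemma conj_by_inv': "bij h \<Longrightarrow> conj_by h (conj_by (inv' h) y) = y"
  using conj_by_inv[of "inv' h" y] by (simp add: bij_imp_bij_inv inv_inv_eq)

lemma comp_list_map_conj_by: "bij h \<Longrightarrow> comp_list (map (conj_by h) ys) = conj_by h (comp_list ys)"
  by (induction ys) (simp_all add: conj_by_comp conj_by_id)

lemma conj_by_permutes:
  assumes "bij h" "y permutes S"
  shows "conj_by h y permutes h ` S"
proof -
  have "bij (conj_by h y)"
    unfolding conj_by_def using assms permutes_bij[OF assms(2)] by (intro bij_comp bij_imp_bij_inv)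
  moreover have "conj_by h y z = z" if "z \<notin> h ` S" for z
  proof -
    obtain z' where z: "z = h z'" using assms(1) by (metis bij_pointE)
    then have "y z' = z'" using that assms(2) by (auto simp: permutes_def)
    then show ?thesis using z conj_by_apply[OF assms(1)] by simp
  qed
  ultimately show ?thesis by (simp add: permutes_def bij_iff)
qed

lemma orbit_conj_by:
  assumes "bij h" "permutation y"
  shows "orbit (conj_by h y) (h z) = h ` orbit y z"
  using assms by (intro orbit_inverse[symmetric]) (simp_all add: conj_by_apply permutation_self_in_orbit)

lemma odd_cycles_conj_by:
  assumes "bij h" "permutation y" "odd_cycles y"
  shows "odd_cycles (conj_by h y)"
  unfolding odd_cycles_def
proof
  fix z
  obtain z' where z: "z = h z'" using assms(1) by (metis bij_pointE)
  have "card (h ` orbit y z') = card (orbit y z')"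
    using assms(1) by (intro card_image) (auto intro: inj_on_subset bij_is_inj)
  then show "odd (card (orbit (conj_by h y) z))"
    using assms by (simp add: z orbit_conj_by odd_cycles_def)
qed

lemma abs_length_conj_by:
  assumes "bij h" "permutation y"
  shows "abs_length (h ` S) (conj_by h y) = abs_length S y"
proof -
  have inj: "inj h" using assms(1) by (rule bij_is_inj)
  have "orbit (conj_by h y) ` h ` S = (`) h ` orbit y ` S"
    by (simp add: image_image orbit_conj_by[OF assms])
  moreover have "card ((`) h ` orbit y ` S) = card (orbit y ` S)"
    using inj by (intro card_image inj_onI) (simp add: inj_image_eq_iff)
  moreover have "card (h ` S) = card S"
    using inj by (intro card_image) (auto intro: inj_on_subset)
  ultimately show ?thesis by (simp add: abs_length_def)
qed

lemma map_conj_by_min_fact: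
  assumes S: "finite S" and h: "bij h" and ys: "ys \<in> min_fact q S w" and w: "w permutes S"
  shows "map (conj_by h) ys \<in> min_fact q (h ` S) (conj_by h w)"
proof -
  have perm: "y \<in> set ys \<Longrightarrow> permutation y" for y
    using ys S by (auto simp: min_fact_def intro: permutes_imp_permutation)
  have "sum_list (map (abs_length (h ` S)) (map (conj_by h) ys)) = sum_list (map (abs_length S) ys)"
    using perm by (intro arg_cong[where f = sum_list]) (simp add: abs_length_conj_by[OF h])
  moreover have "abs_length (h ` S) (conj_by h w) = abs_length S w"
    using w S by (simp add: abs_length_conj_by[OF h] permutes_imp_permutation)
  ultimately show ?thesis
    using ys perm by (auto simp: min_fact_def comp_list_map_conj_by[OF h] conj_by_permutes[OF h]
      odd_cycles_conj_by[OF h] simp del: map_map)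
qed

lemma card_min_fact_conj_by:
  assumes S: "finite S" and h: "bij h" and w: "w permutes S"
    and P: "\<And>ys. ys \<in> min_fact q S w \<Longrightarrow> P ys \<longleftrightarrow> P' (map (conj_by h) ys)"
  shows "card {ys \<in> min_fact q S w. P ys} = card {ys \<in> min_fact q (h ` S) (conj_by h w). P' ys}"
proof (rule bij_betw_same_card)
  show "bij_betw (map (conj_by h)) {ys \<in> min_fact q S w. P ys}
    {ys \<in> min_fact q (h ` S) (conj_by h w). P' ys}"
  proof (rule bij_betw_byWitness[where f' = "map (conj_by (inv' h))"])
    have S': "finite (h ` S)" and h': "bij (inv' h)" and w': "conj_by h w permutes h ` S"
      using S h w by (auto simp: bij_imp_bij_inv conj_by_permutes)
    have im: "inv' h ` h ` S = S" using h by (simp add: bij_is_inj image_inv_f_f)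
    have bwd: "map (conj_by (inv' h)) zs \<in> min_fact q S w"
      if "zs \<in> min_fact q (h ` S) (conj_by h w)" for zs
      using map_conj_by_min_fact[OF S' h' that w'] by (simp add: im conj_by_inv[OF h])
    show "\<forall>ys\<in>{ys \<in> min_fact q S w. P ys}. map (conj_by (inv' h)) (map (conj_by h) ys) = ys"
      using h by (simp add: conj_by_inv comp_def)
    show inv: "\<forall>ys\<in>{ys \<in> min_fact q (h ` S) (conj_by h w). P' ys}.
        map (conj_by h) (map (conj_by (inv' h)) ys) = ys"
      using h by (simp add: conj_by_inv' comp_def)
    show "map (conj_by h) ` {ys \<in> min_fact q S w. P ys} \<subseteq> {ys \<in> min_fact q (h ` S) (conj_by h w). P' ys}"
      using map_conj_by_min_fact[OF S h _ w] P by auto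
    show "map (conj_by (inv' h)) ` {ys \<in> min_fact q (h ` S) (conj_by h w). P' ys} \<subseteq> {ys \<in> min_fact q S w. P ys}"
      using bwd P inv by auto
  qed
qed

text \<open>Says that \<open>u y u\<^sup>-\<^sup>1\<close> fixes \<open>p\<close>, for the factor \<open>y\<close> with index \<open>i\<close> and the product \<open>u\<close> of the
  factors before it; avoiding the inverse makes it compatible with restriction to invariant sets.\<close>

definition fixes_at :: "nat \<Rightarrow> 'a \<Rightarrow> ('a \<Rightarrow> 'a) list \<Rightarrow> bool" where
  "fixes_at i p ys \<longleftrightarrow> (\<forall>z. comp_list (take i ys) z = p \<longrightarrow> (ys ! i) z = z)"

text \<open>The bijection is the Hurwitz move that carries the factor with index \<open>i\<close> to the front.\<close>

lemma card_min_fact_fixes_at: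
  assumes S: "finite S" and i: "i < q"
  shows "card {ys \<in> min_fact q S w. fixes_at i p ys} = card {ys \<in> min_fact q S w. (ys ! 0) p = p}"
proof (rule bij_betw_same_card)
  define m where "m ys = conj_by (comp_list (take i ys)) (ys ! i) # take i ys @ drop (Suc i) ys"
    for ys :: "('a \<Rightarrow> 'a) list"
  define m' where "m' ys = take i (tl ys) @
      conj_by (inv' (comp_list (take i (tl ys)))) (hd ys) # drop i (tl ys)"
    for ys :: "('a \<Rightarrow> 'a) list"
  have conj: "conj_by u y permutes S \<and> odd_cycles (conj_by u y) \<and> abs_length S (conj_by u y) = abs_length S y"
    if "u permutes S" "y permutes S" "odd_cycles y" for u y :: "'a \<Rightarrow> 'a"
  proof -
    have u: "bij u" using that(1) by (rule permutes_bij)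
    have pu: "permutation y" using that(2) S by (rule permutes_imp_permutation)
    have "u ` S = S" using that(1) by (rule permutes_image)
    then show ?thesis
      using conj_by_permutes[OF u that(2)] odd_cycles_conj_by[OF u pu that(3)]
        abs_length_conj_by[OF u pu, of S] by simp
  qed
  have M: "m ys \<in> min_fact q S w \<and> (fixes_at i p ys \<longleftrightarrow> (m ys ! 0) p = p) \<and> m' (m ys) = ys"
    if ys: "ys \<in> min_fact q S w" for ys
  proof -
    obtain us y vs where eq: "ys = us @ y # vs" and us: "length us = i"
      using i ys id_take_nth_drop[of i ys]
      by (intro that[of "take i ys" "ys ! i" "drop (Suc i) ys"]) (simp_all add: min_fact_def)
    define u where "u = comp_list us"
    have u: "u permutes S" using ys by (auto simp: u_def min_fact_def eq intro: comp_list_permutes)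
    then have bu: "bij u" by (rule permutes_bij)
    have y: "y permutes S" "odd_cycles y" using ys by (auto simp: min_fact_def eq)
    have m: "m ys = conj_by u y # us @ vs" using us by (simp add: m_def eq u_def nth_append)
    have "conj_by u y \<circ> u = u \<circ> y" using bu by (simp add: conj_by_def fun_eq_iff bij_is_inj)
    then have "comp_list (m ys) = comp_list ys"
      unfolding m by (simp add: eq u_def[symmetric] comp_assoc[symmetric])
    then have "m ys \<in> min_fact q S w"
      using ys conj[OF u y] unfolding m by (simp add: min_fact_def eq)
    moreover have "m' (m ys) = ys"
      using us bu unfolding m by (simp add: m'_def eq u_def[symmetric] conj_by_inv)
    moreover have "fixes_at i p ys \<longleftrightarrow> y (inv' u p) = inv' u p"
      using us bu by (auto simp: fixes_at_def eq nth_append u_def[symmetric] bij_is_inj bij_is_surj surj_f_inv_f)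
    moreover have "(m ys ! 0) p = p \<longleftrightarrow> y (inv' u p) = inv' u p"
      unfolding m using bu by (simp add: conj_by_def) (metis bij_inv_eq_iff)
    ultimately show ?thesis by blast
  qed
  have M': "m' ys \<in> min_fact q S w \<and> m (m' ys) = ys" if ys: "ys \<in> min_fact q S w" for ys
  proof -
    obtain y zs where "ys = y # zs" using i ys by (cases ys) (auto simp: min_fact_def)
    moreover obtain us vs where "zs = us @ vs" "length us = i"
      using i ys \<open>ys = y # zs\<close> by (intro that[of "take i zs" "drop i zs"]) (auto simp: min_fact_def)
    ultimately have eq: "ys = y # us @ vs" and us: "length us = i" by auto
    define u where "u = comp_list us"
    have u: "u permutes S" using ys by (auto simp: u_def min_fact_def eq intro: comp_list_permutes)
    then have bu: "bij u" by (rule permutes_bij)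
    have iu: "inv' u permutes S" using u by (rule permutes_inv)
    have y: "y permutes S" "odd_cycles y" using ys by (auto simp: min_fact_def eq)
    have m: "m' ys = us @ conj_by (inv' u) y # vs" using us by (simp add: m'_def eq u_def)
    have "u \<circ> conj_by (inv' u) y = y \<circ> u"
      using bu by (simp add: conj_by_def fun_eq_iff bij_is_surj surj_f_inv_f inv_inv_eq)
    then have "comp_list (m' ys) = comp_list ys"
      unfolding m by (simp add: eq u_def[symmetric] comp_assoc[symmetric])
    then have "m' ys \<in> min_fact q S w"
      using ys conj[OF iu y] unfolding m by (simp add: min_fact_def eq)
    moreover have "m (m' ys) = ys"
      using us bu unfolding m by (simp add: m_def eq nth_append u_def[symmetric] conj_by_inv')
    ultimately show ?thesis by blast
  qed
  show "bij_betw m {ys \<in> min_fact q S w. fixes_at i p ys} {ys \<in> min_fact q S w. (ys ! 0) p = p}"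
  proof (rule bij_betw_byWitness[where f' = m'])
    show "\<forall>ys\<in>{ys \<in> min_fact q S w. fixes_at i p ys}. m' (m ys) = ys" using M by simp
    show "\<forall>ys\<in>{ys \<in> min_fact q S w. (ys ! 0) p = p}. m (m' ys) = ys" using M' by simp
    show "m ` {ys \<in> min_fact q S w. fixes_at i p ys} \<subseteq> {ys \<in> min_fact q S w. (ys ! 0) p = p}"
      using M by auto
    show "m' ` {ys \<in> min_fact q S w. (ys ! 0) p = p} \<subseteq> {ys \<in> min_fact q S w. fixes_at i p ys}"
    proof (intro image_subsetI CollectI conjI)
      fix ys assume ys: "ys \<in> {ys \<in> min_fact q S w. (ys ! 0) p = p}"
      then show "m' ys \<in> min_fact q S w" using M' by simp
      then show "fixes_at i p (m' ys)" using M[of "m' ys"] M'[of ys] ys by simp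
    qed
  qed
qed

section \<open>Factorisations of permutations with an invariant set\<close>

lemma orbit_subset_closed:
  assumes "\<And>z. z \<in> C \<Longrightarrow> f z \<in> C" "z \<in> C"
  shows "orbit f z \<subseteq> C"
proof
  fix s assume "s \<in> orbit f z"
  then show "s \<in> C" by induction (auto intro: assms)
qed

lemma perm_restrict_permutes:
  assumes "finite C" "inj f" "\<And>z. z \<in> C \<Longrightarrow> f z \<in> C"
  shows "perm_restrict f C permutes C"
proof (rule bij_imp_permutes)
  have "f ` C = C" using assms by (intro endo_inj_surj) (auto intro: inj_on_subset)
  then have "bij_betw f C C" using assms(2) by (auto simp: bij_betw_def intro: inj_on_subset)
  then show "bij_betw (perm_restrict f C) C C"
    by (rule bij_betw_cong[THEN iffD1, rotated]) (simp add: perm_restrict_simps)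
qed (simp add: perm_restrict_simps)

lemma orbit_perm_restrict:
  assumes "\<And>z. z \<in> C \<Longrightarrow> f z \<in> C"
  shows "orbit (perm_restrict f C) z = (if z \<in> C then orbit f z else {z})"
proof (cases "z \<in> C")
  case True
  then have "orbit f z = orbit (perm_restrict f C) z"
    by (rule orbit_cong0) (auto simp: perm_restrict_simps assms)
  then show ?thesis using True by simp
qed (simp add: orbit_eq_singleton_iff perm_restrict_simps)

lemma comp_list_map_perm_restrict:
  assumes "\<forall>y\<in>set ys. \<forall>z\<in>C. y z \<in> C"
  shows "comp_list (map (\<lambda>y. perm_restrict y C) ys) = perm_restrict (comp_list ys) C"
    and "z \<in> C \<Longrightarrow> comp_list ys z \<in> C"
proof -
  have closed: "\<forall>z\<in>C. comp_list ys z \<in> C" using assms by (induction ys) auto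
  then show "z \<in> C \<Longrightarrow> comp_list ys z \<in> C" by blast
  show "comp_list (map (\<lambda>y. perm_restrict y C) ys) = perm_restrict (comp_list ys) C"
    using assms
  proof (induction ys)
    case Nil
    show ?case by (simp add: perm_restrict_def fun_eq_iff)
  next
    case (Cons y ys)
    have "\<forall>z\<in>C. comp_list ys z \<in> C" using Cons.prems by (induction ys) auto
    then show ?case using Cons by (auto simp: perm_restrict_def fun_eq_iff)
  qed
qed

text \<open>Two parts at a time; the three pieces of a cut cycle come from using the locale twice,
  the second time inside the second part.\<close>

locale two_part =
  fixes C D :: "'a set"
  assumes finC: "finite C" and finD: "finite D" and disj: "C \<inter> D = {}"
begin

definition splits :: "('a \<Rightarrow> 'a) \<Rightarrow> bool" where
  "splits y \<longleftrightarrow> y permutes (C \<union> D) \<and> (\<forall>z\<in>C. y z \<in> C) \<and> (\<forall>z\<in>D. y z \<in> D)"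

text \<open>Every cycle of \<open>y\<close> lies in \<open>C\<close>, lies in \<open>D\<close> or is
  a single point outside both, so cycle counts add up and the parity condition separates.\<close>

lemma splits_restrict:
  assumes "splits y"
  shows splits_left: "perm_restrict y C permutes C"
    and splits_right: "perm_restrict y D permutes D"
    and splits_comp: "perm_restrict y C \<circ> perm_restrict y D = y"
    and splits_odd_cycles: "odd_cycles y \<longleftrightarrow> odd_cycles (perm_restrict y C) \<and> odd_cycles (perm_restrict y D)"
    and splits_abs_length: "abs_length (C \<union> D) y =
      abs_length C (perm_restrict y C) + abs_length D (perm_restrict y D)"
proof -
  have y: "y permutes (C \<union> D)" and yC: "\<And>z. z \<in> C \<Longrightarrow> y z \<in> C" and yD: "\<And>z. z \<in> D \<Longrightarrow> y z \<in> D"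
    using assms by (auto simp: splits_def)
  show left: "perm_restrict y C permutes C"
    using finC permutes_inj[OF y] yC by (rule perm_restrict_permutes)
  show right: "perm_restrict y D permutes D"
    using finD permutes_inj[OF y] yD by (rule perm_restrict_permutes)
  show "perm_restrict y C \<circ> perm_restrict y D = y"
    using perm_restrict_union[OF left right disj] y by simp
  have oC: "orbit (perm_restrict y C) z = (if z \<in> C then orbit y z else {z})" for z
    using yC by (rule orbit_perm_restrict)
  have oD: "orbit (perm_restrict y D) z = (if z \<in> D then orbit y z else {z})" for z
    using yD by (rule orbit_perm_restrict)
  have out: "orbit y z = {z}" if "z \<notin> C \<union> D" for z
    using y that by (simp add: orbit_eq_singleton_iff permutes_not_in)
  show "odd_cycles y \<longleftrightarrow> odd_cycles (perm_restrict y C) \<and> odd_cycles (perm_restrict y D)"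
  proof
    assume "odd_cycles y"
    then show "odd_cycles (perm_restrict y C) \<and> odd_cycles (perm_restrict y D)"
      by (simp add: odd_cycles_def oC oD)
  next
    assume "odd_cycles (perm_restrict y C) \<and> odd_cycles (perm_restrict y D)"
    then show "odd_cycles y"
      unfolding odd_cycles_def oC oD using out by (metis Un_iff)
  qed
  have "orbit y ` C \<inter> orbit y ` D = {}"
  proof -
    have "orbit y a \<noteq> orbit y b" if "a \<in> C" "b \<in> D" for a b
      using orbit_subset_closed[of C y a] orbit_subset_closed[of D y b] yC yD that disj
        orbit_nonempty[of y a] by blast
    then show ?thesis by blast
  qed
  then have "card (orbit y ` (C \<union> D)) = card (orbit y ` C) + card (orbit y ` D)"
    by (simp add: image_Un card_Un_disjoint finC finD)
  moreover have "orbit (perm_restrict y C) ` C = orbit y ` C" "orbit (perm_restrict y D) ` D = orbit y ` D"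
    by (simp_all add: oC oD)
  moreover have "card (orbit y ` C) \<le> card C" "card (orbit y ` D) \<le> card D"
    using finC finD by (simp_all add: card_image_le)
  ultimately show "abs_length (C \<union> D) y =
      abs_length C (perm_restrict y C) + abs_length D (perm_restrict y D)"
    by (simp add: abs_length_def card_Un_disjoint finC finD disj)
qed

lemma splits_combine:
  assumes "u permutes C" "v permutes D"
  shows "splits (u \<circ> v)" "perm_restrict (u \<circ> v) C = u" "perm_restrict (u \<circ> v) D = v"
proof -
  have "u permutes (C \<union> D)" "v permutes (C \<union> D)" using assms by (auto intro: permutes_subset)
  then have p: "(u \<circ> v) permutes (C \<union> D)" by (rule permutes_compose[rotated])
  have uv: "(u \<circ> v) z = u z \<and> u z \<in> C" if "z \<in> C" for z
  proof -
    have "v z = z" using that disj assms(2) by (intro permutes_not_in) auto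
    then show ?thesis using that assms(1) by (simp add: permutes_in_image)
  qed
  have vu: "(u \<circ> v) z = v z \<and> v z \<in> D" if "z \<in> D" for z
  proof -
    have "v z \<in> D" using that assms by (simp add: permutes_in_image)
    moreover have "u (v z) = v z" using calculation disj assms(1) by (intro permutes_not_in) auto
    ultimately show ?thesis by simp
  qed
  show "splits (u \<circ> v)" using p uv vu by (auto simp: splits_def)
  show "perm_restrict (u \<circ> v) C = u" "perm_restrict (u \<circ> v) D = v"
    using uv vu assms by (auto simp: perm_restrict_def fun_eq_iff permutes_not_in)
qed

lemma sum_abs_length_splits:
  assumes "\<forall>y\<in>set ys. splits y"
  shows "sum_list (map (abs_length (C \<union> D)) ys) =
    sum_list (map (abs_length C) (map (\<lambda>y. perm_restrict y C) ys)) +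
    sum_list (map (abs_length D) (map (\<lambda>y. perm_restrict y D) ys))"
  using assms by (induction ys) (simp_all add: splits_abs_length)

text \<open>By minimality a factor moves each point within its cycle under \<open>w\<close>, and
  such a cycle does not leave \<open>C\<close> or \<open>D\<close>.\<close>

lemma min_fact_splits:
  assumes w: "splits w" and ys: "ys \<in> min_fact q (C \<union> D) w" and y: "y \<in> set ys"
  shows "splits y"
proof -
  have wC: "\<And>z. z \<in> C \<Longrightarrow> w z \<in> C" and wD: "\<And>z. z \<in> D \<Longrightarrow> w z \<in> D"
    using w by (auto simp: splits_def)
  have fin: "finite (C \<union> D)" using finC finD by simp
  have "y z \<in> orbit w z" if "z \<in> C \<union> D" for z
    using minimal_factor_in_orbit[OF fin, of ys y z] ys y that by (auto simp: min_fact_def)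
  then show ?thesis
    using orbit_subset_closed[of C w] orbit_subset_closed[of D w] wC wD ys y
    by (simp add: splits_def min_fact_def) blast
qed

text \<open>The prefix product preserves \<open>C\<close> and \<open>D\<close> and is the identity
  elsewhere, so a point that it sends to \<open>p\<close> lies in \<open>D\<close>, where
  restriction changes nothing.\<close>

lemma fixes_at_perm_restrict_right:
  assumes ys: "\<forall>y\<in>set ys. splits y" and i: "i < length ys" and p: "p \<in> D"
  shows "fixes_at i p (map (\<lambda>y. perm_restrict y D) ys) \<longleftrightarrow> fixes_at i p ys"
proof -
  let ?u = "comp_list (take i ys)"
  have sC: "\<forall>y\<in>set (take i ys). \<forall>z\<in>C. y z \<in> C" and sD: "\<forall>y\<in>set (take i ys). \<forall>z\<in>D. y z \<in> D"
    using ys by (auto simp: splits_def dest: in_set_takeD)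
  have u: "?u permutes C \<union> D"
    using ys by (intro comp_list_permutes) (auto simp: splits_def dest: in_set_takeD)
  have r: "comp_list (take i (map (\<lambda>y. perm_restrict y D) ys)) = perm_restrict ?u D"
    using comp_list_map_perm_restrict(1)[OF sD] by (simp add: take_map)
  have 1: "z \<in> D" if "?u z = p" for z
    using that comp_list_map_perm_restrict(2)[OF sC, of z] u p disj by (metis Un_iff disjoint_iff permutes_not_in)
  have 2: "z \<in> D" if "perm_restrict ?u D z = p" for z
    using that p by (auto simp: perm_restrict_def split: if_splits)
  have 3: "perm_restrict ?u D z = ?u z" "(map (\<lambda>y. perm_restrict y D) ys ! i) z = (ys ! i) z" if "z \<in> D" for z
    using i that by (simp_all add: perm_restrict_simps)
  show ?thesis
    unfolding fixes_at_def r
  proof (intro iffI allI impI)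
    fix z assume "\<forall>z. perm_restrict ?u D z = p \<longrightarrow> (map (\<lambda>y. perm_restrict y D) ys ! i) z = z" "?u z = p"
    then show "(ys ! i) z = z" using 1[of z] 3[of z] by simp
  next
    fix z assume "\<forall>z. ?u z = p \<longrightarrow> (ys ! i) z = z" "perm_restrict ?u D z = p"
    then show "(map (\<lambda>y. perm_restrict y D) ys ! i) z = z" using 2[of z] 3[of z] by simp
  qed
qed

lemma fixes_at_perm_restrict_left:
  assumes ys: "\<forall>y\<in>set ys. splits y" and i: "i < length ys" and p: "p \<in> C"
  shows "fixes_at i p (map (\<lambda>y. perm_restrict y C) ys) \<longleftrightarrow> fixes_at i p ys"
proof -
  interpret swap: two_part D C using finC finD disj by unfold_locales auto
  have "\<forall>y\<in>set ys. swap.splits y"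
    using ys by (auto simp: splits_def swap.splits_def Un_commute)
  then show ?thesis using i p by (rule swap.fixes_at_perm_restrict_right)
qed

text \<open>Restriction to both parts, with inverse given by composing corresponding factors. The
  point to check is that each restricted factorisation is minimal by itself.\<close>

lemma card_min_fact_split:
  assumes w: "splits w"
  shows "card {ys \<in> min_fact q (C \<union> D) w.
      P (map (\<lambda>y. perm_restrict y C) ys) \<and> Q (map (\<lambda>y. perm_restrict y D) ys)} =
    card {ys \<in> min_fact q C (perm_restrict w C). P ys} *
    card {ys \<in> min_fact q D (perm_restrict w D). Q ys}"
proof -
  let ?rC = "map (\<lambda>y. perm_restrict y C)" and ?rD = "map (\<lambda>y. perm_restrict y D)"
  let ?A = "{ys \<in> min_fact q (C \<union> D) w. P (?rC ys) \<and> Q (?rD ys)}"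
  let ?B = "{ys \<in> min_fact q C (perm_restrict w C). P ys}"
  let ?B' = "{ys \<in> min_fact q D (perm_restrict w D). Q ys}"
  note spl = min_fact_splits[OF w]
  have fwd: "?rC ys \<in> min_fact q C (perm_restrict w C) \<and> ?rD ys \<in> min_fact q D (perm_restrict w D)"
    if ys: "ys \<in> min_fact q (C \<union> D) w" for ys
  proof -
    have s: "\<forall>y\<in>set ys. splits y" using spl[OF ys] by blast
    have cC: "comp_list (?rC ys) = perm_restrict w C" and cD: "comp_list (?rD ys) = perm_restrict w D"
      using comp_list_map_perm_restrict(1)[of ys] s ys by (auto simp: splits_def min_fact_def)
    have pC: "\<And>y. y \<in> set (?rC ys) \<Longrightarrow> y permutes C" and pD: "\<And>y. y \<in> set (?rD ys) \<Longrightarrow> y permutes D"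
      using s splits_left splits_right by auto
    \<comment> \<open>The two total lengths have the right sum, and each is at least the length of
      its product by subadditivity; so both bounds are attained.\<close>
    have "sum_list (map (abs_length C) (?rC ys)) + sum_list (map (abs_length D) (?rD ys)) =
        abs_length C (perm_restrict w C) + abs_length D (perm_restrict w D)"
      using ys sum_abs_length_splits[OF s] splits_abs_length[OF w] by (simp add: min_fact_def)
    moreover have "abs_length C (perm_restrict w C) \<le> sum_list (map (abs_length C) (?rC ys))"
      using finC pC unfolding cC[symmetric] by (rule abs_length_comp_list_le)
    moreover have "abs_length D (perm_restrict w D) \<le> sum_list (map (abs_length D) (?rD ys))"
      using finD pD unfolding cD[symmetric] by (rule abs_length_comp_list_le)
    ultimately have
      "sum_list (map (abs_length C) (?rC ys)) = abs_length C (perm_restrict w C)"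
      "sum_list (map (abs_length D) (?rD ys)) = abs_length D (perm_restrict w D)"
      by linarith+
    moreover have "\<forall>y\<in>set (?rC ys). odd_cycles y" "\<forall>y\<in>set (?rD ys). odd_cycles y"
      using ys s splits_odd_cycles by (auto simp: min_fact_def)
    moreover have "length (?rC ys) = q" "length (?rD ys) = q" using ys by (simp_all add: min_fact_def)
    ultimately show ?thesis
      unfolding min_fact_def mem_Collect_eq using pC pD cC cD by (intro conjI ballI) blast+
  qed
  have bwd: "map2 (\<circ>) us vs \<in> min_fact q (C \<union> D) w \<and> ?rC (map2 (\<circ>) us vs) = us \<and> ?rD (map2 (\<circ>) us vs) = vs"
    if us: "us \<in> min_fact q C (perm_restrict w C)" and vs: "vs \<in> min_fact q D (perm_restrict w D)" for us vs
  proof -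
    let ?ys = "map2 (\<circ>) us vs"
    have len: "length us = q" "length vs = q" using us vs by (auto simp: min_fact_def)
    have u: "us ! k permutes C" "odd_cycles (us ! k)" and v: "vs ! k permutes D" "odd_cycles (vs ! k)"
      if "k < q" for k using us vs that len by (auto simp: min_fact_def)
    have rC: "?rC ?ys = us" and rD: "?rD ?ys = vs"
      using len u v splits_combine by (auto intro!: nth_equalityI)
    have s: "\<forall>y\<in>set ?ys. splits y"
      using len u v splits_combine(1) by (auto simp: in_set_conv_nth)
    have "odd_cycles (us ! k \<circ> vs ! k)" if "k < q" for k
      using splits_odd_cycles[OF splits_combine(1)] splits_combine(2,3) u[OF that] v[OF that] by metis
    then have o: "\<forall>y\<in>set ?ys. odd_cycles y"
      using len by (auto simp: in_set_conv_nth)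
    have sC: "\<forall>y\<in>set ?ys. \<forall>z\<in>C. y z \<in> C" and sD: "\<forall>y\<in>set ?ys. \<forall>z\<in>D. y z \<in> D"
      using s unfolding splits_def by blast+
    have sc: "splits (comp_list ?ys)"
      unfolding splits_def
    proof (intro conjI ballI)
      show "comp_list ?ys permutes C \<union> D" using s by (intro comp_list_permutes) (auto simp: splits_def)
      show "z \<in> C \<Longrightarrow> comp_list ?ys z \<in> C" for z using sC by (rule comp_list_map_perm_restrict(2))
      show "z \<in> D \<Longrightarrow> comp_list ?ys z \<in> D" for z using sD by (rule comp_list_map_perm_restrict(2))
    qed
    have "comp_list us = perm_restrict (comp_list ?ys) C" "comp_list vs = perm_restrict (comp_list ?ys) D"
      using comp_list_map_perm_restrict(1)[OF sC] comp_list_map_perm_restrict(1)[OF sD]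
      unfolding rC rD .
    moreover have "comp_list us = perm_restrict w C" "comp_list vs = perm_restrict w D"
      using us vs by (simp_all add: min_fact_def)
    ultimately have c: "comp_list ?ys = w"
      using splits_comp[OF sc] splits_comp[OF w] by argo
    have "sum_list (map (abs_length (C \<union> D)) ?ys) = abs_length (C \<union> D) w"
      using us vs sum_abs_length_splits[OF s] splits_abs_length[OF w] unfolding rC rD
      by (simp add: min_fact_def)
    moreover have "\<forall>y\<in>set ?ys. y permutes C \<union> D" using s by (simp add: splits_def)
    moreover have "length ?ys = q" using len by simp
    ultimately have "?ys \<in> min_fact q (C \<union> D) w"
      unfolding min_fact_def mem_Collect_eq using o c by blast
    then show ?thesis using rC rD by blast
  qed
  have "bij_betw (\<lambda>ys. (?rC ys, ?rD ys)) ?A (?B \<times> ?B')"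
  proof (rule bij_betw_byWitness[where f' = "\<lambda>(us, vs). map2 (\<circ>) us vs"])
    show "\<forall>ys\<in>?A. (\<lambda>(us, vs). map2 (\<circ>) us vs) (?rC ys, ?rD ys) = ys"
    proof
      fix ys assume "ys \<in> ?A"
      then have "\<forall>y\<in>set ys. splits y" using spl by blast
      then show "(\<lambda>(us, vs). map2 (\<circ>) us vs) (?rC ys, ?rD ys) = ys"
        by (auto intro!: nth_equalityI simp: splits_comp)
    qed
    show "\<forall>a\<in>?B \<times> ?B'. (\<lambda>ys. (?rC ys, ?rD ys)) ((\<lambda>(us, vs). map2 (\<circ>) us vs) a) = a"
      using bwd by auto
    show "(\<lambda>ys. (?rC ys, ?rD ys)) ` ?A \<subseteq> ?B \<times> ?B'" using fwd by auto
    show "(\<lambda>(us, vs). map2 (\<circ>) us vs) ` (?B \<times> ?B') \<subseteq> ?A"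
    proof (intro image_subsetI)
      fix a assume "a \<in> ?B \<times> ?B'"
      then obtain us vs where a: "a = (us, vs)" and us: "us \<in> ?B" and vs: "vs \<in> ?B'" by auto
      show "(\<lambda>(us, vs). map2 (\<circ>) us vs) a \<in> ?A"
        using bwd[of us vs] us vs unfolding a by (simp del: map_map)
    qed
  qed
  then show ?thesis by (simp add: bij_betw_same_card card_cartesian_product)
qed

end

section \<open>Cutting a long cycle by a three-cycle\<close>

text \<open>The long cycle on a half-open interval. With both ends free, the three pieces of a cut
  cycle are again of this form.\<close>

definition rot :: "nat \<Rightarrow> nat \<Rightarrow> nat \<Rightarrow> nat" where
  "rot l h z = (if l \<le> z \<and> z < h then if Suc z < h then Suc z else l else z)"

lemma rot_permutes: "rot l h permutes {l..<h}"
proof (rule bij_imp_permutes)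
  show "bij_betw (rot l h) {l..<h} {l..<h}"
    by (rule bij_betw_byWitness[where f' = "\<lambda>z. if z = l then h - 1 else z - 1"])
      (auto simp: rot_def split: if_splits)
qed (auto simp: rot_def)

lemma orbit_rotation:
  assumes lh: "l < h" and step: "\<And>k. l \<le> k \<Longrightarrow> Suc k < h \<Longrightarrow> f k = Suc k" and wrap: "f (h - 1) = l"
    and z: "z \<in> {l..<h}"
  shows "orbit f z = {l..<h}"
proof -
  have pow: "(f ^^ k) l = l + k" if "l + k < h" for k
    using that by (induction k) (simp_all add: step)
  have "(f ^^ Suc (h - l - 1)) l = f (l + (h - l - 1))" using lh by (simp add: pow)
  also have "\<dots> = l" using lh wrap by simp
  finally have "(f ^^ (h - l)) l = l" using lh by (simp add: Suc_diff_Suc)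
  then have "orbit f l = {(f ^^ m) l | m. m < h - l}" using lh by (intro orbit_altdef_bounded) auto
  also have "\<dots> = {l..<h}"
  proof (intro equalityI subsetI)
    fix x assume "x \<in> {l..<h}"
    then have "x = (f ^^ (x - l)) l" "x - l < h - l" by (auto simp: pow)
    then show "x \<in> {(f ^^ m) l | m. m < h - l}" by blast
  qed (auto simp: pow)
  finally have "orbit f l = {l..<h}" .
  then have "cyclic_on f {l..<h}" using lh by (auto simp: cyclic_on_def)
  then show ?thesis using z by (rule orbit_cyclic_eq3)
qed

lemma orbit_rot: "l < h \<Longrightarrow> z \<in> {l..<h} \<Longrightarrow> orbit (rot l h) z = {l..<h}"
  by (rule orbit_rotation) (auto simp: rot_def)

lemma abs_length_rot:
  assumes "l < h"
  shows "abs_length {l..<h} (rot l h) = h - l - 1"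
proof -
  have "orbit (rot l h) ` {l..<h} = {{l..<h}}" using assms by (auto simp: orbit_rot)
  then show ?thesis by (simp add: abs_length_def)
qed

text \<open>For \<open>m = 0\<close> and \<open>i \<le> q\<close> the plain count would be 1, from
  the list of identities. The value 0 is imposed so that the generating function has no constant
  term and empty pieces contribute nothing.\<close>

definition cyc_count :: "nat \<Rightarrow> nat \<Rightarrow> nat \<Rightarrow> nat" where
  "cyc_count q i m = (if m = 0 then 0 else
    card {ys \<in> min_fact q {0..<m} (rot 0 m). \<forall>j<i. (ys ! j) 0 = 0})"

lemma card_min_fact_rot:
  assumes lh: "l < h" and i: "i \<le> q"
  shows "card {ys \<in> min_fact q {l..<h} (rot l h). \<forall>j<i. (ys ! j) l = l} = cyc_count q i (h - l)"
proof -
  \<comment> \<open>Conjugation needs a bijection of all natural numbers: the interval is shifted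
    down to start at 0, and the points below \<open>l\<close> take the places that become
    free.\<close>
  define s where "s z = (if l \<le> z \<and> z < h then z - l else if z < l then z + (h - l) else z)" for z
  define s' where "s' z = (if z < h - l then z + l else if z < h then z - (h - l) else z)" for z
  have bij: "bij s"
    by (rule bij_betw_byWitness[where f' = s']) (use lh in \<open>auto simp: s_def s'_def\<close>)
  have inj: "inj s" using bij by (rule bij_is_inj)
  have im: "s ` {l..<h} = {0..<h - l}"
  proof (intro equalityI subsetI)
    fix x assume "x \<in> {0..<h - l}"
    then have "x = s (x + l)" "x + l \<in> {l..<h}" by (auto simp: s_def)
    then show "x \<in> s ` {l..<h}" by blast
  qed (auto simp: s_def)
  have sl: "s l = 0" using lh by (simp add: s_def)
  have comm: "s (rot l h z) = rot 0 (h - l) (s z)" for z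
    using lh by (auto simp: s_def rot_def)
  have "conj_by s (rot l h) = rot 0 (h - l)"
  proof
    fix x
    obtain z where "x = s z" using bij by (metis bij_pointE)
    then show "conj_by s (rot l h) x = rot 0 (h - l) x"
      using conj_by_apply[OF bij] comm by simp
  qed
  moreover have "card {ys \<in> min_fact q {l..<h} (rot l h). \<forall>j<i. (ys ! j) l = l} =
    card {ys \<in> min_fact q (s ` {l..<h}) (conj_by s (rot l h)). \<forall>j<i. (ys ! j) 0 = 0}"
  proof (rule card_min_fact_conj_by)
    fix ys assume ys: "ys \<in> min_fact q {l..<h} (rot l h)"
    have "(map (conj_by s) ys ! j) 0 = 0 \<longleftrightarrow> (ys ! j) l = l" if "j < i" for j
    proof -
      have "(map (conj_by s) ys ! j) 0 = conj_by s (ys ! j) (s l)"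
        using that i ys sl by (simp add: min_fact_def)
      also have "\<dots> = s ((ys ! j) l)" using bij by (rule conj_by_apply)
      finally show ?thesis using inj sl by (metis injD)
    qed
    then show "(\<forall>j<i. (ys ! j) l = l) = (\<forall>j<i. (map (conj_by s) ys ! j) 0 = 0)" by simp
  qed (use bij rot_permutes in auto)
  ultimately show ?thesis using lh by (simp add: cyc_count_def im)
qed

text \<open>Three steps of the rotation are redirected: \<open>a - 1\<close> now goes to 0,
  \<open>b - 1\<close> to \<open>a\<close> and \<open>N - 1\<close> to \<open>b\<close>. The last
  claim concerns the opposite orientation, which keeps the full length; it later forces the order of
  the two cutting points.\<close>

lemma rot_cut:
  assumes ab: "0 < a" "a < b" "b < N"
  defines "w' \<equiv> cyc3 0 b a \<circ> rot 0 N"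
  shows rot_cut_permutes: "w' permutes {0..<N}"
    and rot_cut_restrict: "perm_restrict w' {0..<a} = rot 0 a" "perm_restrict w' {a..<b} = rot a b"
      "perm_restrict w' {b..<N} = rot b N"
    and cyc3_comp_rot_cut: "cyc3 0 a b \<circ> w' = rot 0 N"
    and abs_length_rot_cut: "abs_length {0..<N} w' + 2 = N - 1"
    and abs_length_cyc3_comp_rot: "abs_length {0..<N} (cyc3 0 a b \<circ> rot 0 N) = N - 1"
proof -
  have in_S: "0 \<in> {0..<N}" "a \<in> {0..<N}" "b \<in> {0..<N}" using ab by auto
  show w': "w' permutes {0..<N}"
    unfolding w'_def by (intro permutes_compose[OF rot_permutes] permutes_cyc3 in_S)
  have val: "w' z = (if z = a - 1 then 0 else if z = b - 1 then a else if z = N - 1 then b else Suc z)"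
    if "z < N" for z
  proof -
    have "cyc3 0 b a v = (if v = 0 then b else if v = b then a else if v = a then 0 else v)" for v
      using ab by (subst cyc3_apply) auto
    moreover have "rot 0 N z = (if z = N - 1 then 0 else Suc z)" using that by (auto simp: rot_def)
    ultimately have "w' z = (if z = N - 1 then b else if Suc z = b then a else if Suc z = a then 0 else Suc z)"
      using ab by (simp add: w'_def)
    then show ?thesis using ab by auto
  qed
  show "perm_restrict w' {0..<a} = rot 0 a" "perm_restrict w' {a..<b} = rot a b"
      "perm_restrict w' {b..<N} = rot b N"
  proof -
    have "w' z = rot 0 a z" if "z \<in> {0..<a}" for z
      using ab that val[of z] by (cases "z = a - 1") (auto simp: rot_def)
    moreover have "w' z = rot a b z" if "z \<in> {a..<b}" for z
      using ab that val[of z] by (cases "z = b - 1") (auto simp: rot_def)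
    moreover have "w' z = rot b N z" if "z \<in> {b..<N}" for z
      using ab that val[of z] by (cases "z = N - 1") (auto simp: rot_def)
    ultimately show "perm_restrict w' {0..<a} = rot 0 a" "perm_restrict w' {a..<b} = rot a b"
        "perm_restrict w' {b..<N} = rot b N"
      by (simp_all add: fun_eq_iff perm_restrict_def) (auto simp: rot_def)
  qed
  show *: "cyc3 0 a b \<circ> w' = rot 0 N"
    using cyc3_inverse[of 0 a b] ab by (simp add: w'_def comp_assoc[symmetric])
  have "orbit w' 0 = {0..<a}" by (rule orbit_rotation) (use ab val in auto)
  moreover have "orbit w' a = {a..<b}" by (rule orbit_rotation) (use ab val in auto)
  moreover have "orbit w' b = {b..<N}" by (rule orbit_rotation) (use ab val in auto)
  ultimately have ne: "orbit w' 0 \<noteq> orbit w' a" "orbit w' 0 \<noteq> orbit w' b" "orbit w' a \<noteq> orbit w' b"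
    using ab by (simp_all add: set_eq_iff) (metis le0 leD less_le_trans le_refl)+
  have "abs_length {0..<N} (cyc3 0 a b \<circ> w') = abs_length {0..<N} w' + 2"
    using w' in_S ne by (intro abs_length_cyc3_comp) auto
  then show len: "abs_length {0..<N} w' + 2 = N - 1" using ab by (simp add: * abs_length_rot)
  \<comment> \<open>The reversed product also arises by merging the three pieces, because the square
    of \<open>cyc3 0 b a\<close> is \<open>cyc3 0 a b\<close>.\<close>
  have "cyc3 0 b a \<circ> w' = cyc3 0 a b \<circ> rot 0 N"
  proof -
    have "cyc3 0 b a \<circ> cyc3 0 b a = cyc3 0 a b"
      using ab by (intro cyc3_square) auto
    then show ?thesis by (simp add: w'_def comp_assoc[symmetric])
  qed
  moreover have "abs_length {0..<N} (cyc3 0 b a \<circ> w') = abs_length {0..<N} w' + 2"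
    using w' in_S ne by (intro abs_length_cyc3_comp) auto
  ultimately show "abs_length {0..<N} (cyc3 0 a b \<circ> rot 0 N) = N - 1" using len by simp
qed

text \<open>The piece containing 0 feels only the conditions on the first \<open>i\<close> factors,
  whereas the conditions at \<open>a\<close> and at \<open>b\<close> fall on one of the other two
  pieces each.\<close>

lemma card_min_fact_rot_cut:
  assumes ab: "0 < a" "a < b" "b < N" and i: "i < q"
  shows "card {ys \<in> min_fact q {0..<N} (cyc3 0 b a \<circ> rot 0 N).
      (\<forall>j<i. (ys ! j) 0 = 0) \<and> fixes_at i a ys \<and> fixes_at i b ys} =
    cyc_count q i a * cyc_count q 1 (b - a) * cyc_count q 1 (N - b)"
proof -
  let ?w = "cyc3 0 b a \<circ> rot 0 N"
  let ?A = "{0..<a}" and ?B = "{a..<b}" and ?C = "{b..<N}" and ?D = "{a..<N}"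
  note w = rot_cut[OF ab]
  have wA: "?w z \<in> ?A" if "z \<in> ?A" for z
    using that w(2) permutes_in_image[OF rot_permutes[of 0 a], of z] by (metis perm_restrict_simps(1))
  have wB: "?w z \<in> ?B" if "z \<in> ?B" for z
    using that w(3) permutes_in_image[OF rot_permutes[of a b], of z] by (metis perm_restrict_simps(1))
  have wC: "?w z \<in> ?C" if "z \<in> ?C" for z
    using that w(4) permutes_in_image[OF rot_permutes[of b N], of z] by (metis perm_restrict_simps(1))
  have D: "?D = ?B \<union> ?C" and N: "{0..<N} = ?A \<union> ?D" using ab by auto
  interpret S: two_part ?A ?D by unfold_locales auto
  interpret T: two_part ?B ?C by unfold_locales auto
  have S: "S.splits ?w"
    unfolding S.splits_def
  proof (intro conjI ballI)
    show "?w permutes ?A \<union> ?D" using w(1) by (simp only: N)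
    show "?w z \<in> ?A" if "z \<in> ?A" for z using that by (rule wA)
    show "?w z \<in> ?D" if "z \<in> ?D" for z using that wB[of z] wC[of z] unfolding D by blast
  qed
  let ?v = "perm_restrict ?w ?D"
  have v: "?v permutes ?B \<union> ?C" using S.splits_right[OF S] by (simp only: D)
  have rB: "perm_restrict ?v ?B = rot a b"
    using w(3) ab by (simp only: perm_restrict_perm_restrict) (simp add: min_def max_def)
  have rC: "perm_restrict ?v ?C = rot b N"
    using w(4) ab by (simp only: perm_restrict_perm_restrict) (simp add: min_def max_def)
  have T: "T.splits ?v"
    unfolding T.splits_def
  proof (intro conjI ballI v)
    fix z assume z: "z \<in> ?B"
    then have "?v z = ?w z" using ab by (intro perm_restrict_simps) auto
    then show "?v z \<in> ?B" using wB[OF z] by simp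
  next
    fix z assume z: "z \<in> ?C"
    then have "?v z = ?w z" using ab by (intro perm_restrict_simps) auto
    then show "?v z \<in> ?C" using wC[OF z] by simp
  qed
  let ?P = "\<lambda>ys. \<forall>j<i. (ys ! j) 0 = (0::nat)" and ?Q = "\<lambda>ys. fixes_at i a ys \<and> fixes_at i b ys"
  have "{ys \<in> min_fact q {0..<N} ?w. ?P ys \<and> ?Q ys} = {ys \<in> min_fact q (?A \<union> ?D) ?w.
      ?P (map (\<lambda>y. perm_restrict y ?A) ys) \<and> ?Q (map (\<lambda>y. perm_restrict y ?D) ys)}"
  proof (intro Collect_cong conj_cong)
    show "ys \<in> min_fact q {0..<N} ?w \<longleftrightarrow> ys \<in> min_fact q (?A \<union> ?D) ?w" for ys by (simp only: N)
    fix ys assume ys: "ys \<in> min_fact q (?A \<union> ?D) ?w"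
    then have len: "length ys = q" by (simp add: min_fact_def)
    have spl: "\<forall>y\<in>set ys. S.splits y" using S.min_fact_splits[OF S ys] by blast
    show "?P ys \<longleftrightarrow> ?P (map (\<lambda>y. perm_restrict y ?A) ys)"
      using ab i len by (auto simp: perm_restrict_simps)
    show "fixes_at i a ys \<longleftrightarrow> fixes_at i a (map (\<lambda>y. perm_restrict y ?D) ys)"
      using S.fixes_at_perm_restrict_right[OF spl, of i a] ab i len by simp
    show "fixes_at i b ys \<longleftrightarrow> fixes_at i b (map (\<lambda>y. perm_restrict y ?D) ys)"
      using S.fixes_at_perm_restrict_right[OF spl, of i b] ab i len by simp
  qed
  then have "card {ys \<in> min_fact q {0..<N} ?w. ?P ys \<and> ?Q ys} =
      card {ys \<in> min_fact q ?A (rot 0 a). ?P ys} * card {ys \<in> min_fact q ?D ?v. ?Q ys}"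
    using S.card_min_fact_split[OF S, of q ?P ?Q] w(2) by simp
  also have "card {ys \<in> min_fact q ?A (rot 0 a). ?P ys} = cyc_count q i a"
    using card_min_fact_rot[of 0 a i q] ab i by simp
  also have "{ys \<in> min_fact q ?D ?v. ?Q ys} = {ys \<in> min_fact q (?B \<union> ?C) ?v.
      fixes_at i a (map (\<lambda>y. perm_restrict y ?B) ys) \<and> fixes_at i b (map (\<lambda>y. perm_restrict y ?C) ys)}"
  proof (intro Collect_cong conj_cong)
    show "ys \<in> min_fact q ?D ?v \<longleftrightarrow> ys \<in> min_fact q (?B \<union> ?C) ?v" for ys by (simp only: D)
    fix ys assume ys: "ys \<in> min_fact q (?B \<union> ?C) ?v"
    then have len: "length ys = q" by (simp add: min_fact_def)
    have spl: "\<forall>y\<in>set ys. T.splits y" using T.min_fact_splits[OF T ys] by blast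
    show "fixes_at i a ys \<longleftrightarrow> fixes_at i a (map (\<lambda>y. perm_restrict y ?B) ys)"
      using T.fixes_at_perm_restrict_left[OF spl, of i a] ab i len by simp
    show "fixes_at i b ys \<longleftrightarrow> fixes_at i b (map (\<lambda>y. perm_restrict y ?C) ys)"
      using T.fixes_at_perm_restrict_right[OF spl, of i b] ab i len by simp
  qed
  also have "card \<dots> = card {ys \<in> min_fact q ?B (rot a b). fixes_at i a ys} *
      card {ys \<in> min_fact q ?C (rot b N). fixes_at i b ys}"
    using T.card_min_fact_split[OF T, of q "fixes_at i a" "fixes_at i b"] unfolding rB rC .
  \<comment> \<open>The Hurwitz move turns the condition at index \<open>i\<close> into one on the
    first factor, so this count does not depend on \<open>i\<close>.\<close>
  also have "card {ys \<in> min_fact q ?B (rot a b). fixes_at i a ys} = cyc_count q 1 (b - a)"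
    using card_min_fact_rot[of a b 1 q] card_min_fact_fixes_at[of ?B i q] ab i by simp
  also have "card {ys \<in> min_fact q ?C (rot b N). fixes_at i b ys} = cyc_count q 1 (N - b)"
    using card_min_fact_rot[of b N 1 q] card_min_fact_fixes_at[of ?C i q] ab i by simp
  finally show ?thesis by (simp only: mult.assoc)
qed

section \<open>Peeling a three-cycle off a factor, and the recurrence\<close>

lemma comp_cyc3:
  assumes "bij u"
  shows "u \<circ> cyc3 x a b = cyc3 (u x) (u a) (u b) \<circ> u"
  using bij_is_inj[OF assms] by (auto simp: cyc3_def transpose_def fun_eq_iff dest: injD)

text \<open>The cycle of \<open>x\<close> passes through \<open>a\<close>, \<open>b\<close>,
  \<open>x\<close> in this order. Cutting out \<open>a\<close> and \<open>b\<close> makes them fixed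
  points and shortens the permutation by two. Oddness excludes a cycle of size two, so the three
  points are distinct.\<close>

lemma odd_cycles_peel:
  assumes S: "finite S" and y: "y permutes S" "odd_cycles y" and x: "x \<in> S" and yx: "y x \<noteq> x"
  defines "b \<equiv> inv' y x"
  defines "a \<equiv> inv' y b"
  defines "y' \<equiv> cyc3 x b a \<circ> y"
  shows "a \<in> S" "b \<in> S" "x \<noteq> a" "x \<noteq> b" "a \<noteq> b" "y' permutes S" "y' a = a" "y' b = b"
    "y = cyc3 x a b \<circ> y'" "odd_cycles y'" "abs_length S y = abs_length S y' + 2"
proof -
  have bijy: "bij y" using y(1) by (rule permutes_bij)
  have yb: "y b = x" and ya: "y a = b"
    using bijy by (simp_all add: a_def b_def bij_is_surj surj_f_inv_f)
  show a: "a \<in> S" and b: "b \<in> S"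
    unfolding a_def b_def permutes_in_image[OF permutes_inv[OF y(1)]] by (rule x)+
  show xb: "x \<noteq> b" using yx yb by metis
  show ab: "a \<noteq> b" using ya yb xb by metis
  show xa: "x \<noteq> a"
  proof
    assume "x = a"
    then have "orbit y x = {x, b}"
      using ya yb permutation_self_in_orbit[OF permutes_imp_permutation[OF y(1) S]]
        orbit_subset_closed[of "{x, b}" y x] orbit.base[of y x] by auto
    then have "card (orbit y x) = 2" using xb by simp
    then show False using y(2) unfolding odd_cycles_def by (metis even_numeral)
  qed
  show y': "y' permutes S" unfolding y'_def by (intro permutes_compose[OF y(1)] permutes_cyc3 x a b)
  show fa: "y' a = a" and fb: "y' b = b"
    using ya yb xa xb ab by (simp_all add: y'_def cyc3_def transpose_def)
  show yy': "y = cyc3 x a b \<circ> y'"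
    using cyc3_inverse[of x a b] xa xb ab by (simp add: y'_def comp_assoc[symmetric])
  note dist = xa xb ab
  show "odd_cycles y'"
    using odd_cycles_cyc3_comp_fixed_iff[OF S y' x a b fa fb dist] y(2) yy' by simp
  have "abs_length S (cyc3 x a b \<circ> y') = abs_length S y' + 2"
    using orbits_distinct_if_fixed[OF permutes_imp_permutation[OF y' S] fa fb dist]
    by (intro abs_length_cyc3_comp[OF S y' x a b])
  then show "abs_length S y = abs_length S y' + 2" using yy' by simp
qed

text \<open>Either the factor with index \<open>i\<close> fixes 0 as well, or a three-cycle is
  peeled off it and moved to the front. The pairs \<open>(a, b)\<close> are the points at which the
  long cycle is then cut.\<close>

lemma cyc_count_rec:
  assumes N: "0 < N" and i: "i < q"
  shows "cyc_count q i N = cyc_count q (Suc i) N +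
    (\<Sum>(a, b) \<in> {(a, b). 0 < a \<and> a < b \<and> b < N}.
      cyc_count q i a * cyc_count q 1 (b - a) * cyc_count q 1 (N - b))"
proof -
  let ?S = "{0..<N}" and ?w = "rot 0 N"
  let ?F = "\<lambda>k. {ys \<in> min_fact q ?S ?w. \<forall>j<k. (ys ! j) 0 = 0}"
  define M where "M = {ys \<in> min_fact q ?S ?w. (\<forall>j<i. (ys ! j) 0 = 0) \<and> (ys ! i) 0 \<noteq> 0}"
  define I where "I = {(a, b). 0 < a \<and> a < b \<and> b < N}"
  define E where "E = (\<lambda>(a, b). {ys \<in> min_fact q ?S (cyc3 0 b a \<circ> ?w).
    (\<forall>j<i. (ys ! j) 0 = 0) \<and> fixes_at i a ys \<and> fixes_at i b ys})"
  have S: "finite ?S" and 0: "0 \<in> ?S" using N by auto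
  have finM: "finite (min_fact q ?S w)" for w :: "nat \<Rightarrow> nat" by (simp add: finite_min_fact)
  \<comment> \<open>On its way to the front the three-cycle passes the prefix \<open>u\<close>,
    which fixes 0 because its factors do. It turns into a three-cycle on 0, \<open>u a\<close> and
    \<open>u b\<close>, and these images are recorded.\<close>
  define \<Phi> where "\<Phi> ys = (let u = comp_list (take i ys); y = ys ! i; b = inv' y 0; a = inv' y b
    in ((u a, u b), ys[i := cyc3 0 b a \<circ> y]))" for ys :: "(nat \<Rightarrow> nat) list"
  define \<Psi> where "\<Psi> = (\<lambda>((a :: nat, b), ys). let u = comp_list (take i ys)
    in ys[i := cyc3 0 (inv' u a) (inv' u b) \<circ> ys ! i])"
  have fwd: "\<Phi> ys \<in> Sigma I E \<and> \<Psi> (\<Phi> ys) = ys" if ys: "ys \<in> M" for ys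
  proof -
    have mf: "ys \<in> min_fact q ?S ?w" using ys by (simp add: M_def)
    obtain us y vs where eq: "ys = us @ y # vs" and us: "length us = i"
      using i mf id_take_nth_drop[of i ys]
      by (intro that[of "take i ys" "ys ! i" "drop (Suc i) ys"]) (simp_all add: min_fact_def)
    define u where "u = comp_list us"
    define b where "b = inv' y 0"
    define a where "a = inv' y b"
    define y' where "y' = cyc3 0 b a \<circ> y"
    have p: "\<And>y. y \<in> set ys \<Longrightarrow> y permutes ?S" and o: "\<And>y. y \<in> set ys \<Longrightarrow> odd_cycles y"
      using mf by (auto simp: min_fact_def)
    have u: "u permutes ?S" unfolding u_def using p eq by (intro comp_list_permutes) auto
    have bu: "bij u" using u by (rule permutes_bij)
    have y: "y permutes ?S" "odd_cycles y" using p o eq by auto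
    have y0: "y 0 \<noteq> 0" using ys us by (simp add: M_def eq nth_append)
    note peel = odd_cycles_peel[OF S y 0 y0, folded b_def, folded a_def, folded y'_def]
    note a = peel(1) and b = peel(2) and dist = peel(3-5) and y' = peel(6) and fa = peel(7)
      and fb = peel(8) and yy' = peel(9) and o' = peel(10) and len = peel(11)
    have u0: "u 0 = 0"
    proof -
      have "\<forall>y\<in>set us. y 0 = 0"
        using ys us by (auto simp: M_def eq in_set_conv_nth nth_append)
      then show ?thesis unfolding u_def by (induction us) auto
    qed
    define ys' where "ys' = us @ y' # vs"
    have \<Phi>: "\<Phi> ys = ((u a, u b), ys')"
      using us by (simp add: \<Phi>_def eq nth_append Let_def u_def a_def b_def y'_def ys'_def list_update_append)
    have c: "comp_list ys' = cyc3 0 (u b) (u a) \<circ> ?w"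
    proof -
      have "comp_list ys' = u \<circ> cyc3 0 b a \<circ> y \<circ> comp_list vs"
        by (simp add: ys'_def u_def y'_def comp_assoc)
      also have "\<dots> = cyc3 0 (u b) (u a) \<circ> (u \<circ> y \<circ> comp_list vs)"
        using comp_cyc3[OF bu, of 0 b a] u0 by (simp add: comp_assoc[symmetric])
      also have "u \<circ> y \<circ> comp_list vs = ?w" using mf by (simp add: min_fact_def eq u_def comp_assoc)
      finally show ?thesis .
    qed
    have p': "\<And>y. y \<in> set ys' \<Longrightarrow> y permutes ?S" and o'': "\<And>y. y \<in> set ys' \<Longrightarrow> odd_cycles y"
      using p o y' o' by (auto simp: ys'_def eq)
    have sum: "sum_list (map (abs_length ?S) ys') + 2 = N - 1"
      using mf len abs_length_rot[OF N] by (simp add: min_fact_def eq ys'_def)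
    have "abs_length ?S (comp_list ys') \<le> sum_list (map (abs_length ?S) ys')"
      using S p' by (rule abs_length_comp_list_le)
    then have le: "abs_length ?S (cyc3 0 (u b) (u a) \<circ> ?w) < N - 1" using sum unfolding c by linarith
    have "u a \<in> ?S" "u b \<in> ?S"
      unfolding permutes_in_image[OF u] by (rule a, rule b)
    moreover have "u a \<noteq> 0" "u b \<noteq> 0" "u a \<noteq> u b"
      using dist u0 by (metis bu bij_is_inj injD)+
    ultimately have ua: "0 < u a" "u a < N" "0 < u b" "u b < N" "u a \<noteq> u b" by simp_all
    \<comment> \<open>In the other order the remaining product would keep length
      \<open>N - 1\<close>, while its factors have total length \<open>N - 3\<close>.\<close>
    have lt: "u a < u b"
    proof (rule ccontr)
      assume "\<not> u a < u b"
      then have "abs_length ?S (cyc3 0 (u b) (u a) \<circ> ?w) = N - 1"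
        using ua by (intro abs_length_cyc3_comp_rot) auto
      then show False using le by simp
    qed
    then have I: "(u a, u b) \<in> I" using ua by (auto simp: I_def)
    have "abs_length ?S (cyc3 0 (u b) (u a) \<circ> ?w) + 2 = N - 1"
      using ua lt by (intro abs_length_rot_cut) auto
    then have mf': "ys' \<in> min_fact q ?S (cyc3 0 (u b) (u a) \<circ> ?w)"
      using mf p' o'' c sum by (simp add: min_fact_def eq ys'_def)
    have "(ys' ! j) 0 = 0" if "j < i" for j
      using ys that us by (auto simp: M_def eq ys'_def nth_append)
    moreover have "fixes_at i (u a) ys'" "fixes_at i (u b) ys'"
      using us fa fb injD[OF bij_is_inj[OF bu]]
      by (auto simp: fixes_at_def ys'_def nth_append u_def[symmetric])
    ultimately have "ys' \<in> E (u a, u b)" using mf' by (simp add: E_def)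
    moreover have "\<Psi> ((u a, u b), ys') = ys"
      using us bu yy' by (simp add: \<Psi>_def ys'_def nth_append list_update_append u_def[symmetric]
        bij_is_inj eq)
    ultimately show ?thesis using I by (simp add: \<Phi>)
  qed
  have bwd: "\<Psi> ((a, b), ys') \<in> M \<and> \<Phi> (\<Psi> ((a, b), ys')) = ((a, b), ys')"
    if ab: "(a, b) \<in> I" and ys': "ys' \<in> E (a, b)" for a b ys'
  proof -
    have lt: "0 < a" "a < b" "b < N" using ab by (auto simp: I_def)
    have mf: "ys' \<in> min_fact q ?S (cyc3 0 b a \<circ> ?w)" using ys' by (simp add: E_def)
    obtain us y' vs where eq: "ys' = us @ y' # vs" and us: "length us = i"
      using i mf id_take_nth_drop[of i ys']
      by (intro that[of "take i ys'" "ys' ! i" "drop (Suc i) ys'"]) (simp_all add: min_fact_def)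
    define u where "u = comp_list us"
    define d where "d = inv' u a"
    define e where "e = inv' u b"
    define y where "y = cyc3 0 d e \<circ> y'"
    have p: "\<And>y. y \<in> set ys' \<Longrightarrow> y permutes ?S" and o: "\<And>y. y \<in> set ys' \<Longrightarrow> odd_cycles y"
      using mf by (auto simp: min_fact_def)
    have u: "u permutes ?S" unfolding u_def using p eq by (intro comp_list_permutes) auto
    have bu: "bij u" using u by (rule permutes_bij)
    have ud: "u d = a" and ue: "u e = b" using bu by (simp_all add: d_def e_def bij_is_surj surj_f_inv_f)
    have d: "d \<in> ?S" and e: "e \<in> ?S"
      unfolding d_def e_def permutes_in_image[OF permutes_inv[OF u]] using lt by simp_all
    have y': "y' permutes ?S" "odd_cycles y'" using p o eq by auto
    have u0: "u 0 = 0"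
    proof -
      have "\<forall>y\<in>set us. y 0 = 0"
        using ys' us by (auto simp: E_def eq in_set_conv_nth nth_append)
      then show ?thesis unfolding u_def by (induction us) auto
    qed
    have dist: "0 \<noteq> d" "0 \<noteq> e" "d \<noteq> e" using lt ud ue u0 by (metis less_irrefl less_trans)+
    have "fixes_at i a ys'" "fixes_at i b ys'" using ys' by (simp_all add: E_def)
    then have fd: "y' d = d" and fe: "y' e = e"
      using us ud ue by (auto simp: fixes_at_def eq nth_append u_def[symmetric])
    have y: "y permutes ?S" unfolding y_def by (intro permutes_compose[OF y'(1)] permutes_cyc3 0 d e)
    have o': "odd_cycles y"
      unfolding y_def using odd_cycles_cyc3_comp_fixed_iff[OF S y'(1) 0 d e fd fe dist] y'(2) by simp
    have len: "abs_length ?S y = abs_length ?S y' + 2"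
      unfolding y_def using orbits_distinct_if_fixed[OF permutes_imp_permutation[OF y'(1) S] fd fe dist]
      by (intro abs_length_cyc3_comp[OF S y'(1) 0 d e])
    define ys where "ys = us @ y # vs"
    have \<Psi>: "\<Psi> ((a, b), ys') = ys"
      using us by (simp add: \<Psi>_def eq nth_append Let_def u_def d_def e_def y_def ys_def list_update_append)
    have "comp_list ys = u \<circ> cyc3 0 d e \<circ> y' \<circ> comp_list vs"
      by (simp add: ys_def u_def y_def comp_assoc)
    also have "\<dots> = cyc3 0 a b \<circ> (u \<circ> y' \<circ> comp_list vs)"
      using comp_cyc3[OF bu, of 0 d e] u0 ud ue by (simp add: comp_assoc[symmetric])
    also have "u \<circ> y' \<circ> comp_list vs = cyc3 0 b a \<circ> ?w"
      using mf by (simp add: min_fact_def eq u_def comp_assoc)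
    also have "cyc3 0 a b \<circ> (cyc3 0 b a \<circ> ?w) = ?w" using lt by (rule cyc3_comp_rot_cut)
    finally have c: "comp_list ys = ?w" .
    have "sum_list (map (abs_length ?S) ys) = N - 1"
      using mf len abs_length_rot_cut[OF lt] by (simp add: min_fact_def eq ys_def)
    then have mf': "ys \<in> min_fact q ?S ?w"
      using mf p o y o' c abs_length_rot[OF N] by (auto simp: min_fact_def eq ys_def)
    have ye: "y e = 0" and yd: "y d = e"
      using fd fe dist by (simp_all add: y_def cyc3_def transpose_def)
    have bijy: "bij y" using y by (rule permutes_bij)
    have "y 0 \<noteq> 0" using ye dist by (metis bijy bij_is_inj injD)
    moreover have "(ys ! j) 0 = 0" if "j < i" for j
      using ys' that us by (auto simp: E_def eq ys_def nth_append)
    ultimately have "ys \<in> M" using mf' us by (simp add: M_def ys_def nth_append)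
    moreover have "inv' y 0 = e" "inv' y e = d" using ye yd bijy by (metis bij_inv_eq_iff)+
    moreover have "cyc3 0 e d \<circ> y = y'"
      using cyc3_inverse[of 0 e d] dist by (simp add: y_def comp_assoc[symmetric])
    ultimately show ?thesis
      unfolding \<Psi> using us ud ue
      by (simp add: \<Phi>_def ys_def nth_append list_update_append u_def[symmetric] Let_def eq)
  qed
  have "bij_betw \<Phi> M (Sigma I E)"
  proof (rule bij_betw_byWitness[where f' = \<Psi>])
    show "\<forall>ys\<in>M. \<Psi> (\<Phi> ys) = ys" and "\<Phi> ` M \<subseteq> Sigma I E" using fwd by blast+
    show "\<forall>x\<in>Sigma I E. \<Phi> (\<Psi> x) = x" and "\<Psi> ` Sigma I E \<subseteq> M" using bwd by auto
  qed
  then have "card M = card (Sigma I E)" by (rule bij_betw_same_card)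
  also have "\<dots> = (\<Sum>x\<in>I. card (E x))"
  proof (rule card_SigmaI)
    show "finite I" by (rule finite_subset[of _ "{0..<N} \<times> {0..<N}"]) (auto simp: I_def)
    show "\<forall>x\<in>I. finite (E x)" using finM by (auto simp: E_def)
  qed
  also have "\<dots> = (\<Sum>(a, b)\<in>I. cyc_count q i a * cyc_count q 1 (b - a) * cyc_count q 1 (N - b))"
    using card_min_fact_rot_cut[OF _ _ _ i] by (intro sum.cong) (auto simp: E_def I_def)
  finally have "card M = \<dots>" .
  moreover have "?F i = ?F (Suc i) \<union> M" "?F (Suc i) \<inter> M = {}"
    by (auto simp: M_def less_Suc_eq)
  then have "card (?F i) = card (?F (Suc i)) + card M"
    using finM by (simp add: card_Un_disjoint M_def)
  ultimately show ?thesis using N by (simp add: cyc_count_def I_def)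
qed

text \<open>If all factors fix 0, so does their product, which is impossible for a long cycle on
  more than one point. On one point only the list of identities remains.\<close>

lemma cyc_count_all: "cyc_count q q N = (if N = 1 then 1 else 0)"
proof (cases "N = 0")
  case False
  have fix0: "comp_list ys 0 = 0" if "\<forall>y\<in>set ys. y 0 = (0::nat)" for ys
    using that by (induction ys) auto
  have *: "rot 0 N 0 = 0" if "ys \<in> min_fact q {0..<N} (rot 0 N)" "\<forall>j<q. (ys ! j) 0 = 0" for ys
  proof -
    have "\<forall>y\<in>set ys. y 0 = 0" using that by (auto simp: min_fact_def in_set_conv_nth)
    then show ?thesis using fix0[of ys] that(1) by (simp add: min_fact_def)
  qed
  show ?thesis
  proof (cases "N = 1")
    case True
    have perm: "y permutes {0..<N} \<longleftrightarrow> y = id" for y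
      using True permutes_sing[of y 0] by (auto simp: permutes_id)
    have id: "rot 0 N = id" using rot_permutes[of 0 N] perm by simp
    have "odd_cycles (id :: nat \<Rightarrow> nat)"
      unfolding odd_cycles_def by (simp add: orbit_eq_singleton_iff[THEN iffD2])
    moreover have "comp_list (replicate q id) = (id :: nat \<Rightarrow> nat)" by (induction q) auto
    moreover have "abs_length {0..<N} id = 0" using abs_length_rot[of 0 N] id True by simp
    ultimately have "{ys \<in> min_fact q {0..<N} (rot 0 N). \<forall>j<q. (ys ! j) 0 = 0} = {replicate q id}"
      unfolding id min_fact_def perm
      by (auto simp: sum_list_replicate map_replicate_const intro!: replicate_eqI)
    then show ?thesis using True by (simp add: cyc_count_def)
  next
    case N1: False
    then have "rot 0 N 0 \<noteq> 0" using False by (simp add: rot_def)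
    then have "\<not> (ys \<in> min_fact q {0..<N} (rot 0 N) \<and> (\<forall>j<q. (ys ! j) 0 = 0))" for ys
      by (elim contrapos_nn conjE) (rule *)
    then have empty: "{ys \<in> min_fact q {0..<N} (rot 0 N). \<forall>j<q. (ys ! j) 0 = 0} = {}"
      unfolding Collect_empty_eq by (rule allI)
    show ?thesis using N1 unfolding cyc_count_def empty by simp
  qed
qed (simp add: cyc_count_def)

section \<open>The generating function\<close>

unbundle fps_syntax

text \<open>Recurrence of the Raney numbers, mirroring
  \<open>V ^ Suc r = V ^ r + fps_X ^ 2 * V ^ (p + r)\<close>. All three terms are rational multiples
  of the one binomial coefficient \<open>m choose n\<close>.\<close>

lemma fuss_catalan_rec:
  fixes p n r :: nat
  assumes p: "0 < p"
  defines "f \<equiv> \<lambda>n r. real r / real (n * p + r) * real ((n * p + r) choose n)"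
  shows "f (Suc n) (Suc r) = f (Suc n) r + f n (p + r)"
proof -
  define m where "m = Suc n * p + r"
  have e1: "Suc n * p + Suc r = Suc m" and e2: "n * p + (p + r) = m" by (simp_all add: m_def)
  have m: "0 < m" using p by (simp add: m_def)
  have rm: "real m = (real n + 1) * real p + real r" by (simp add: m_def algebra_simps)
  have "(Suc n) * (Suc m choose Suc n) = Suc m * (m choose n)" by (rule Suc_times_binomial)
  then have 1: "(real n + 1) * real (Suc m choose Suc n) = (real m + 1) * real (m choose n)"
    by (metis of_nat_Suc of_nat_mult add.commute)
  have "Suc m choose Suc n = (m choose n) + (m choose Suc n)" by simp
  then have 2: "(real n + 1) * real (m choose Suc n) = (real m - real n) * real (m choose n)"
    using 1 by (simp add: algebra_simps)
  have "f (Suc n) (Suc r) = (real r + 1) / (real m + 1) * real (Suc m choose Suc n)"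
    unfolding f_def e1 by (simp add: add_ac del: binomial_Suc_Suc)
  also have "real (Suc m choose Suc n) = (real m + 1) / (real n + 1) * real (m choose n)"
    using 1 by (simp add: field_simps)
  also have "(real r + 1) / (real m + 1) * ((real m + 1) / (real n + 1) * real (m choose n)) =
      (real r + 1) / (real n + 1) * real (m choose n)"
    by (simp add: add_pos_nonneg[THEN less_imp_neq] divide_simps)
  finally have L: "f (Suc n) (Suc r) = (real r + 1) / (real n + 1) * real (m choose n)" .
  have "f (Suc n) r = real r / real m * real (m choose Suc n)"
    unfolding f_def m_def by (rule refl)
  also have "real (m choose Suc n) = (real m - real n) / (real n + 1) * real (m choose n)"
    using 2 by (simp add: field_simps)
  finally have R1: "f (Suc n) r = real r / real m * ((real m - real n) / (real n + 1) * real (m choose n))" .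
  have R2: "f n (p + r) = (real p + real r) / real m * real (m choose n)"
    unfolding f_def e2 by simp
  have "(real r + 1) / (real n + 1) = real r / real m * ((real m - real n) / (real n + 1)) + (real p + real r) / real m"
    using m by (simp add: divide_simps) (simp add: rm algebra_simps)
  then show ?thesis unfolding L R1 R2 by (simp add: distrib_right)
qed

lemma fps_power_coeff_fuss_catalan:
  fixes V :: "real fps"
  assumes V: "V = 1 + fps_X ^ 2 * V ^ p" and p: "0 < p" and r: "0 < r"
  shows "(V ^ r) $ (2 * n) = real r / real (n * p + r) * real ((n * p + r) choose n)"
  using r
proof (induction n arbitrary: r)
  case 0
  have "V $ 0 = 1" by (subst V) (simp add: fps_X_power_mult_nth)
  then show ?case using 0 by (simp add: fps_power_zeroth)
next
  case (Suc n)
  note IH = Suc.IH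
  \<comment> \<open>Past \<open>n = 0\<close> the formula also holds for \<open>r = 0\<close>, both
    sides being 0, and this starts the inner induction. At \<open>n = 0\<close> it would fail
    there.\<close>
  have *: "(V ^ r) $ (2 * Suc n) = real r / real (Suc n * p + r) * real ((Suc n * p + r) choose Suc n)" for r
  proof (induction r)
    case (Suc r)
    have "V ^ Suc r = V ^ r * V" by simp
    also have "\<dots> = V ^ r * (1 + fps_X ^ 2 * V ^ p)" by (subst (2) V) simp
    also have "\<dots> = V ^ r + fps_X ^ 2 * V ^ (p + r)" by (simp add: algebra_simps power_add)
    finally have A: "(V ^ Suc r) $ (2 * Suc n) = (V ^ r) $ (2 * Suc n) + (V ^ (p + r)) $ (2 * n)"
      by (simp add: fps_X_power_mult_nth)
    have "0 < p + r" using p by simp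
    from A Suc.IH IH[OF this] fuss_catalan_rec[OF p, where n = n and r = r] show ?case by argo
  qed simp
  show ?case by (rule *)
qed

section \<open>From the recurrence to the coefficients\<close>

definition cyc_fps :: "nat \<Rightarrow> nat \<Rightarrow> real fps" where
  "cyc_fps q i = Abs_fps (\<lambda>m. real (cyc_count q i m))"

lemma cyc_fps_rec:
  assumes "i < q"
  shows "cyc_fps q i = cyc_fps q (Suc i) + cyc_fps q i * cyc_fps q 1 * cyc_fps q 1"
proof (rule fps_ext)
  fix N
  let ?c = "cyc_count q"
  have c0: "?c k 0 = 0" for k by (simp add: cyc_count_def)
  let ?g = "\<lambda>(b, a). ?c i a * ?c 1 (b - a) * ?c 1 (N - b)"
  let ?I = "{(a, b). 0 < a \<and> a < b \<and> b < N}"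
  have "(cyc_fps q i * cyc_fps q 1 * cyc_fps q 1) $ N =
      real (\<Sum>b=0..N. \<Sum>a=0..b. ?g (b, a))"
    by (simp add: cyc_fps_def fps_mult_nth sum_distrib_right)
  also have "(\<Sum>b=0..N. \<Sum>a=0..b. ?g (b, a)) = sum ?g (Sigma {0..N} (\<lambda>b. {0..b}))"
    by (subst sum.Sigma) auto
  \<comment> \<open>\<open>c0\<close> removes the boundary pairs, those with \<open>a = 0\<close>,
    \<open>a = b\<close> or \<open>b = N\<close>.\<close>
  also have "\<dots> = sum ?g {(b, a). 0 < a \<and> a < b \<and> b < N}"
    by (rule sum.mono_neutral_right) (auto simp: c0 not_less le_less)
  also have "\<dots> = (\<Sum>(a, b)\<in>?I. ?c i a * ?c 1 (b - a) * ?c 1 (N - b))"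
    by (rule sum.reindex_bij_witness[of _ prod.swap prod.swap]) auto
  finally have conv: "(cyc_fps q i * cyc_fps q 1 * cyc_fps q 1) $ N =
      real (\<Sum>(a, b)\<in>?I. ?c i a * ?c 1 (b - a) * ?c 1 (N - b))" .
  show "cyc_fps q i $ N = (cyc_fps q (Suc i) + cyc_fps q i * cyc_fps q 1 * cyc_fps q 1) $ N"
  proof (cases "N = 0")
    case True
    then show ?thesis by (simp add: cyc_fps_def c0)
  next
    case False
    then have "?c i N = ?c (Suc i) N + (\<Sum>(a, b)\<in>?I. ?c i a * ?c 1 (b - a) * ?c 1 (N - b))"
      using assms by (intro cyc_count_rec) auto
    then show ?thesis unfolding fps_add_nth conv by (simp add: cyc_fps_def)
  qed
qed

lemma cyc_count_odd:
  assumes q: "1 \<le> q"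
  shows "real (cyc_count q 0 (2 * n + 1)) =
    real q / real (n * (2 * q - 1) + q) * real ((n * (2 * q - 1) + q) choose n)"
proof -
  define G where "G = cyc_fps q 1"
  have G0: "G $ 0 = 0" by (simp add: G_def cyc_fps_def cyc_count_def)
  define V where "V = inverse (1 - G * G)"
  have V: "V * (1 - G * G) = 1"
    unfolding V_def by (rule inverse_mult_eq_1) (simp add: G0)
  have step: "cyc_fps q i = V * cyc_fps q (Suc i)" if "i < q" for i
  proof -
    have "cyc_fps q (Suc i) = (1 - G * G) * cyc_fps q i"
      using cyc_fps_rec[OF that] by (simp add: G_def algebra_simps)
    then have "V * cyc_fps q (Suc i) = (V * (1 - G * G)) * cyc_fps q i" by (simp only: mult.assoc)
    then show ?thesis using V by simp
  qed
  have "cyc_fps q q = fps_X" by (rule fps_ext) (simp add: cyc_fps_def cyc_count_all fps_X_def)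
  then have pow: "cyc_fps q (q - k) = V ^ k * fps_X" if "k \<le> q" for k
    using that
  proof (induction k)
    case (Suc k)
    then have "cyc_fps q (q - Suc k) = V * cyc_fps q (q - k)"
      using step[of "q - Suc k"] by (simp add: Suc_diff_Suc)
    then show ?case using Suc by (simp add: mult.assoc)
  qed simp
  have G: "G = V ^ (q - 1) * fps_X" using pow[of "q - 1"] q by (simp add: G_def)
  have "V = 1 + V * (G * G)" using V by (simp add: algebra_simps)
  \<comment> \<open>One \<open>V\<close> in front and \<open>q - 1\<close> from each
    \<open>G\<close> give the exponent \<open>2 * q - 1\<close>, the parameter \<open>p\<close> of
    the Raney numbers.\<close>
  also have "V * (G * G) = fps_X ^ 2 * V ^ (2 * q - 1)"
  proof -
    have "2 * q - 1 = Suc ((q - 1) + (q - 1))" using q by simp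
    then have "V ^ (2 * q - 1) = V * (V ^ (q - 1) * V ^ (q - 1))"
      by (simp only: power_add power_Suc)
    then show ?thesis by (simp add: G power2_eq_square algebra_simps)
  qed
  finally have Veq: "V = 1 + fps_X ^ 2 * V ^ (2 * q - 1)" .
  have "real (cyc_count q 0 (2 * n + 1)) = cyc_fps q 0 $ (2 * n + 1)" by (simp add: cyc_fps_def)
  also have "\<dots> = (V ^ q) $ (2 * n)" using pow[of q] by simp
  finally show ?thesis using fps_power_coeff_fuss_catalan[OF Veq, of q n] q by simp
qed

section \<open>Three-cycle length\<close>

lemma odd_cycles_id: "odd_cycles id"
proof -
  have "orbit id z = {z}" for z :: 'a by (simp add: orbit_eq_singleton_iff)
  then show ?thesis by (simp add: odd_cycles_def)
qed

lemma abs_length_id: "abs_length S id = 0"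
proof -
  have "orbit id z = {z}" for z :: 'a by (simp add: orbit_eq_singleton_iff)
  then have "card (orbit id ` S) = card S" by (simp add: card_image)
  then show ?thesis by (simp add: abs_length_def)
qed

lemma three_cycles_eq_cyc3:
  "three_cycles N = {cyc3 x a b | x a b. {x, a, b} \<subseteq> {1..N} \<and> x \<noteq> a \<and> x \<noteq> b \<and> a \<noteq> b}"
proof -
  have eq: "cycle_of_list [x, a, b] = cyc3 x a b" if "x \<noteq> a" "x \<noteq> b" "a \<noteq> b" for x a b :: nat
    using that by (intro ext) (simp add: cyc3_apply transpose_def)
  show ?thesis
  proof (intro equalityI subsetI)
    fix t assume "t \<in> three_cycles N"
    then obtain cs where cs: "t = cycle_of_list cs" "distinct cs" "length cs = 3" "set cs \<subseteq> {1..N}"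
      by auto
    obtain x a b where "cs = [x, a, b]" using stupid_lemma[OF cs(3)] by auto
    then show "t \<in> {cyc3 x a b | x a b. {x, a, b} \<subseteq> {1..N} \<and> x \<noteq> a \<and> x \<noteq> b \<and> a \<noteq> b}"
      using cs eq[of x a b] by auto
  next
    fix t assume "t \<in> {cyc3 x a b | x a b. {x, a, b} \<subseteq> {1..N} \<and> x \<noteq> a \<and> x \<noteq> b \<and> a \<noteq> b}"
    then obtain x a b where t: "t = cyc3 x a b" "{x, a, b} \<subseteq> {1..N}" "x \<noteq> a" "x \<noteq> b" "a \<noteq> b"
      by blast
    then have "t = cycle_of_list [x, a, b]" "distinct [x, a, b]" "set [x, a, b] \<subseteq> {1..N}"
      using eq[of x a b] by auto
    then show "t \<in> three_cycles N" by (intro CollectI exI[of _ "[x, a, b]"]) simp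
  qed
qed

lemma three_cycleE:
  assumes "t \<in> three_cycles N"
  obtains x a b where "t = cyc3 x a b" "x \<in> {1..N}" "a \<in> {1..N}" "b \<in> {1..N}" "x \<noteq> a" "x \<noteq> b" "a \<noteq> b"
  using assms unfolding three_cycles_eq_cyc3 by blast

lemma three_cycle_permutes: "t \<in> three_cycles N \<Longrightarrow> t permutes {1..N}"
  by (elim three_cycleE) (simp add: permutes_cyc3)

lemma abs_length_three_cycle:
  assumes "t \<in> three_cycles N"
  shows "abs_length {1..N} t = 2"
proof -
  obtain x a b where t: "t = cyc3 x a b" "x \<in> {1..N}" "a \<in> {1..N}" "b \<in> {1..N}" "x \<noteq> a" "x \<noteq> b" "a \<noteq> b"
    using assms by (rule three_cycleE)
  have "orbit id z = {z}" for z :: nat by (simp add: orbit_eq_singleton_iff)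
  then have "abs_length {1..N} (cyc3 x a b \<circ> id) = abs_length {1..N} id + 2"
    using t by (intro abs_length_cyc3_comp permutes_id) auto
  then show ?thesis by (simp add: t(1) abs_length_id)
qed

lemma abs_length_three_cycles_le:
  assumes "set ts \<subseteq> three_cycles N"
  shows "abs_length {1..N} (comp_list ts) \<le> 2 * length ts"
proof -
  have "abs_length {1..N} (comp_list ts) \<le> sum_list (map (abs_length {1..N}) ts)"
    by (rule abs_length_comp_list_le[OF finite_atLeastAtMost])
      (rule three_cycle_permutes, erule subsetD[OF assms])
  also have "map (abs_length {1..N}) ts = map (\<lambda>_. 2) ts"
    by (intro map_cong refl abs_length_three_cycle) (erule subsetD[OF assms])
  finally show ?thesis by (simp add: sum_list_triv)
qed

text \<open>The length is the largest possible, so each three-cycle raises it by two. By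
  \<open>orbits_distinct_if_cyc3_length\<close> it then merges three distinct cycles, and odd sizes
  stay odd.\<close>

lemma odd_cycles_three_cycles:
  assumes "set ts \<subseteq> three_cycles N" "abs_length {1..N} (comp_list ts) = 2 * length ts"
  shows "odd_cycles (comp_list ts)"
  using assms
proof (induction ts)
  case Nil
  show ?case unfolding comp_list_simps by (rule odd_cycles_id)
next
  case (Cons t ts)
  let ?w = "comp_list ts"
  have ts: "set ts \<subseteq> three_cycles N" and t: "t \<in> three_cycles N" using Cons.prems by auto
  have "abs_length {1..N} (t \<circ> ?w) = 2 * length (t # ts)"
    using Cons.prems(2) unfolding comp_list_simps by assumption
  then have tw: "abs_length {1..N} (t \<circ> ?w) = 2 + 2 * length ts" by simp
  have w: "?w permutes {1..N}"
    by (rule comp_list_permutes) (rule three_cycle_permutes, erule subsetD[OF ts])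
  have "abs_length {1..N} (comp_list [t, ?w]) \<le> sum_list (map (abs_length {1..N}) [t, ?w])"
    using w three_cycle_permutes[OF t] by (intro abs_length_comp_list_le) auto
  then have "abs_length {1..N} (t \<circ> ?w) \<le> 2 + abs_length {1..N} ?w"
    using abs_length_three_cycle[OF t] by simp
  moreover have "abs_length {1..N} ?w \<le> 2 * length ts" using ts by (rule abs_length_three_cycles_le)
  ultimately have len: "abs_length {1..N} ?w = 2 * length ts" using tw by linarith
  have odd: "odd_cycles ?w" using ts len by (rule Cons.IH)
  obtain x a b where xab: "t = cyc3 x a b" "x \<in> {1..N}" "a \<in> {1..N}" "b \<in> {1..N}"
    using t by (rule three_cycleE)
  have "abs_length {1..N} (cyc3 x a b \<circ> ?w) = abs_length {1..N} ?w + 2"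
    using tw len unfolding xab(1) by linarith
  then have "orbit ?w x \<noteq> orbit ?w a" "orbit ?w x \<noteq> orbit ?w b" "orbit ?w a \<noteq> orbit ?w b"
    using orbits_distinct_if_cyc3_length[OF _ w xab(2-4)] by auto
  then have "odd_cycles (cyc3 x a b \<circ> ?w)"
    using odd_cycles_cyc3_comp[OF _ w xab(2-4)] odd by simp
  then show ?case unfolding comp_list_simps xab(1) .
qed

text \<open>Peel off three-cycles until the identity remains; each lowers the length by exactly
  two.\<close>

lemma odd_cycles_imp_three_cycles:
  assumes "y permutes {1..N}" "odd_cycles y"
  shows "\<exists>ts. set ts \<subseteq> three_cycles N \<and> comp_list ts = y \<and> 2 * length ts = abs_length {1..N} y"
  using assms
proof (induction "abs_length {1..N} y" arbitrary: y rule: less_induct)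
  case less
  show ?case
  proof (cases "y = id")
    case True
    then show ?thesis by (intro exI[of _ "[]"]) (simp add: abs_length_id)
  next
    case False
    then obtain x where yx: "y x \<noteq> x" by (auto simp: fun_eq_iff)
    then have x: "x \<in> {1..N}" using less.prems(1) by (metis permutes_not_in)
    define b where "b = inv' y x"
    define a where "a = inv' y b"
    define y' where "y' = cyc3 x b a \<circ> y"
    note peel = odd_cycles_peel[OF _ less.prems x yx, folded b_def, folded a_def, folded y'_def, OF finite_atLeastAtMost]
    obtain ts where ts: "set ts \<subseteq> three_cycles N" "comp_list ts = y'" "2 * length ts = abs_length {1..N} y'"
      using less.hyps[of y'] peel(6,10,11) by auto
    have "cyc3 x a b \<in> three_cycles N"
      unfolding three_cycles_eq_cyc3 using x peel(1-5) by blast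
    then have "set (cyc3 x a b # ts) \<subseteq> three_cycles N" using ts(1) by simp
    moreover have "comp_list (cyc3 x a b # ts) = y"
      unfolding comp_list_simps ts(2) by (rule peel(9)[symmetric])
    moreover have "2 * length (cyc3 x a b # ts) = abs_length {1..N} y"
      unfolding peel(11) ts(3)[symmetric] by simp
    ultimately show ?thesis by blast
  qed
qed

section \<open>Three-cycle length against length in transpositions\<close>

lemma ell3_eq_Least:
  "ell3 N x = (LEAST k. \<exists>ts. length ts = k \<and> set ts \<subseteq> three_cycles N \<and> comp_list ts = x)"
  unfolding ell3_def comp_list_def alt_group_mult alt_group_one by simp

lemma ell3_le:
  assumes "set ts \<subseteq> three_cycles N"
  shows "ell3 N (comp_list ts) \<le> length ts"
  unfolding ell3_eq_Least using assms by (intro Least_le) blast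

lemma alt_group_comp_closed:
  "x \<in> carrier (alt_group N) \<Longrightarrow> y \<in> carrier (alt_group N) \<Longrightarrow> x \<circ> y \<in> carrier (alt_group N)"
  using group.subgroup_self[OF alt_group_is_group, of N]
  by (metis alt_group_mult subgroup.m_closed)

lemma id_in_alt_group: "id \<in> carrier (alt_group N)"
  by (simp add: alt_group_carrier permutes_id)

lemma comp_list_in_alt_group:
  "set ys \<subseteq> carrier (alt_group N) \<Longrightarrow> comp_list ys \<in> carrier (alt_group N)"
  by (induction ys) (simp_all add: id_in_alt_group alt_group_comp_closed)

text \<open>The three-cycles generate the alternating group and are closed under inverses, so the
  minimum in \<open>ell3\<close> is taken over a nonempty set.\<close>

lemma ell3_attained:
  assumes "x \<in> carrier (alt_group N)"
  shows "\<exists>ts. length ts = ell3 N x \<and> set ts \<subseteq> three_cycles N \<and> comp_list ts = x"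
proof -
  have "x \<in> generate (alt_group N) (three_cycles N)"
    using assms unfolding alt_group_carrier_as_three_cycles .
  then have "\<exists>ts. set ts \<subseteq> three_cycles N \<and> comp_list ts = x"
  proof (induction rule: generate.induct)
    case one
    show ?case by (intro exI[of _ "[]"]) (simp add: alt_group_one)
  next
    case (incl h)
    then show ?case by (intro exI[of _ "[h]"]) simp
  next
    case (inv h)
    obtain x a b where h: "h = cyc3 x a b" "x \<in> {1..N}" "a \<in> {1..N}" "b \<in> {1..N}" "x \<noteq> a" "x \<noteq> b" "a \<noteq> b"
      using inv by (rule three_cycleE)
    have "inv\<^bsub>alt_group N\<^esub> h = inv' h"
      using inv three_cycles_incl by (intro alt_group_inv_equality) blast
    also have "\<dots> = cyc3 x b a"
      unfolding h(1) using h(5-7) by (intro inv_unique_comp cyc3_inverse) auto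
    finally have eq: "inv\<^bsub>alt_group N\<^esub> h = cyc3 x b a" .
    have "cyc3 x b a \<in> three_cycles N" unfolding three_cycles_eq_cyc3 using h by blast
    then show ?case unfolding eq by (intro exI[of _ "[cyc3 x b a]"]) simp
  next
    case (eng g h)
    then obtain ts us where "set ts \<subseteq> three_cycles N" "comp_list ts = g" "set us \<subseteq> three_cycles N" "comp_list us = h"
      by blast
    then show ?case by (intro exI[of _ "ts @ us"]) (simp add: alt_group_mult)
  qed
  then have "\<exists>k ts. length ts = k \<and> set ts \<subseteq> three_cycles N \<and> comp_list ts = x" by simp
  then show ?thesis unfolding ell3_eq_Least by (rule LeastI_ex)
qed

lemma ell3_comp_le:
  assumes "x \<in> carrier (alt_group N)" "y \<in> carrier (alt_group N)"
  shows "ell3 N (x \<circ> y) \<le> ell3 N x + ell3 N y"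
proof -
  obtain ts us where "length ts = ell3 N x" "set ts \<subseteq> three_cycles N" "comp_list ts = x"
    "length us = ell3 N y" "set us \<subseteq> three_cycles N" "comp_list us = y"
    using ell3_attained[OF assms(1)] ell3_attained[OF assms(2)] by (elim exE conjE) (rule that)
  then show ?thesis using ell3_le[of "ts @ us" N] by simp
qed

lemma ell3_id: "ell3 N id = 0"
  using ell3_le[of "[]" N] by simp

lemma ell3_comp_list_le:
  "set ys \<subseteq> carrier (alt_group N) \<Longrightarrow> ell3 N (comp_list ys) \<le> sum_list (map (ell3 N) ys)"
proof (induction ys)
  case (Cons y ys)
  then show ?case
    using ell3_comp_le[of y N "comp_list ys"] comp_list_in_alt_group[of ys N] by (simp del: comp_apply)
qed (simp add: ell3_id)

lemma abs_length_le_ell3: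
  assumes "x \<in> carrier (alt_group N)"
  shows "abs_length {1..N} x \<le> 2 * ell3 N x"
    and "abs_length {1..N} x = 2 * ell3 N x \<Longrightarrow> odd_cycles x"
proof -
  obtain ts where ts: "length ts = ell3 N x" "set ts \<subseteq> three_cycles N" "comp_list ts = x"
    using ell3_attained[OF assms] by (elim exE conjE) (rule that)
  show "abs_length {1..N} x \<le> 2 * ell3 N x"
    using abs_length_three_cycles_le[OF ts(2)] unfolding ts .
  show "odd_cycles x" if "abs_length {1..N} x = 2 * ell3 N x"
    using odd_cycles_three_cycles[OF ts(2)] that unfolding ts .
qed

lemma ell3_odd_cycles:
  assumes "x permutes {1..N}" "odd_cycles x"
  shows "x \<in> carrier (alt_group N)" "2 * ell3 N x = abs_length {1..N} x"
proof -
  obtain ts where ts: "set ts \<subseteq> three_cycles N" "comp_list ts = x" "2 * length ts = abs_length {1..N} x"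
    using odd_cycles_imp_three_cycles[OF assms] by blast
  show x: "x \<in> carrier (alt_group N)"
    using comp_list_in_alt_group[of ts N] ts three_cycles_incl[of N] by blast
  show "2 * ell3 N x = abs_length {1..N} x"
    using abs_length_le_ell3(1)[OF x] ell3_le[OF ts(1)] ts by simp
qed

lemma sum_list_map_eq_imp_eq:
  fixes f g :: "'a \<Rightarrow> nat"
  assumes "\<And>y. y \<in> set ys \<Longrightarrow> f y \<le> g y" "sum_list (map g ys) \<le> sum_list (map f ys)" "y \<in> set ys"
  shows "f y = g y"
  using assms
proof (induction ys)
  case (Cons z zs)
  have "f z \<le> g z" "sum_list (map f zs) \<le> sum_list (map g zs)"
    using Cons.prems(1) by (auto intro: sum_list_mono)
  then have "f z = g z" "sum_list (map g zs) \<le> sum_list (map f zs)" using Cons.prems(2) by auto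
  then show ?case using Cons by auto
qed simp

text \<open>Twice \<open>ell3 N c\<close> equals the length of \<open>c\<close>, which is at most
  the sum of the lengths of the factors, which is at most twice the sum of their
  \<open>ell3\<close>. Additivity closes the circle, so every factor attains equality, and this
  means odd cycles.\<close>

lemma ell3_factorisations_eq_min_fact:
  assumes c: "c permutes {1..N}" "odd_cycles c"
  shows "{ys. length ys = q \<and> set ys \<subseteq> carrier (alt_group N) \<and> comp_list ys = c \<and>
      sum_list (map (ell3 N) ys) = ell3 N c} = min_fact q {1..N} c"
proof (intro equalityI subsetI)
  let ?L = "abs_length {1..N}"
  have dbl: "sum_list (map (\<lambda>y. 2 * ell3 N y) ys) = 2 * sum_list (map (ell3 N) ys)" for ys
    by (rule sum_list_const_mult)
  fix ys
  {
    assume "ys \<in> {ys. length ys = q \<and> set ys \<subseteq> carrier (alt_group N) \<and> comp_list ys = c \<and>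
      sum_list (map (ell3 N) ys) = ell3 N c}"
    then have ys: "length ys = q" "set ys \<subseteq> carrier (alt_group N)" "comp_list ys = c"
      "sum_list (map (ell3 N) ys) = ell3 N c" by auto
    have perm: "\<And>y. y \<in> set ys \<Longrightarrow> y permutes {1..N}" using ys(2) by (auto simp: alt_group_carrier)
    have "sum_list (map (\<lambda>y. 2 * ell3 N y) ys) = ?L c"
      unfolding dbl ys(4) using ell3_odd_cycles(2)[OF c] .
    also have "\<dots> \<le> sum_list (map ?L ys)"
      using abs_length_comp_list_le[of "{1..N}" ys] perm ys(3) by simp
    finally have le: "sum_list (map (\<lambda>y. 2 * ell3 N y) ys) \<le> sum_list (map ?L ys)" .
    have eq: "?L y = 2 * ell3 N y" if "y \<in> set ys" for y
      using abs_length_le_ell3(1) ys(2) le that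
      by (intro sum_list_map_eq_imp_eq[where g = "\<lambda>y. 2 * ell3 N y" and ys = ys]) auto
    then have "odd_cycles y" if "y \<in> set ys" for y
      using that ys(2) abs_length_le_ell3(2) by blast
    moreover have "sum_list (map ?L ys) = ?L c"
      using eq dbl[of ys] ys(4) ell3_odd_cycles(2)[OF c] by (simp cong: map_cong)
    ultimately show "ys \<in> min_fact q {1..N} c"
      using ys perm by (simp add: min_fact_def)
  next
    assume ys: "ys \<in> min_fact q {1..N} c"
    then have "y \<in> carrier (alt_group N) \<and> 2 * ell3 N y = ?L y" if "y \<in> set ys" for y
      using that ell3_odd_cycles[of y N] by (simp add: min_fact_def)
    then have sub: "set ys \<subseteq> carrier (alt_group N)" and "map (\<lambda>y. 2 * ell3 N y) ys = map ?L ys" by auto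
    then have "2 * sum_list (map (ell3 N) ys) = sum_list (map ?L ys)" using dbl[of ys] by argo
    also have "\<dots> = 2 * ell3 N c" using ys ell3_odd_cycles(2)[OF c] by (simp add: min_fact_def)
    finally show "ys \<in> {ys. length ys = q \<and> set ys \<subseteq> carrier (alt_group N) \<and> comp_list ys = c \<and>
        sum_list (map (ell3 N) ys) = ell3 N c}"
      using ys sub by (simp add: min_fact_def)
  }
qed

section \<open>Multichains as factorisations\<close>

text \<open>Both ends take part, from \<open>u\<close> to the first entry and from the last entry to
  \<open>c\<close>, hence one quotient more than entries. The start \<open>u\<close> is
  \<open>id\<close> in the application and varies in the inductions.\<close>

primrec quotients :: "(nat \<Rightarrow> nat) \<Rightarrow> (nat \<Rightarrow> nat) \<Rightarrow> (nat \<Rightarrow> nat) list \<Rightarrow> (nat \<Rightarrow> nat) list" where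
  "quotients c u [] = [inv' u \<circ> c]"
| "quotients c u (x # xs) = (inv' u \<circ> x) # quotients c x xs"

text \<open>Undoes \<open>quotients\<close>, except that the full product \<open>c\<close> appears
  as an extra last entry; hence the later \<open>butlast\<close>.\<close>

primrec partial_products :: "(nat \<Rightarrow> nat) \<Rightarrow> (nat \<Rightarrow> nat) list \<Rightarrow> (nat \<Rightarrow> nat) list" where
  "partial_products u [] = []"
| "partial_products u (y # ys) = (u \<circ> y) # partial_products (u \<circ> y) ys"

lemma length_quotients [simp]: "length (quotients c u xs) = Suc (length xs)"
  by (induction xs arbitrary: u) auto

lemma length_partial_products [simp]: "length (partial_products u ys) = length ys"
  by (induction ys arbitrary: u) auto

lemma bij_comp_inv: "bij u \<Longrightarrow> u \<circ> (inv' u \<circ> x) = x"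
  by (simp add: fun_eq_iff bij_is_surj surj_f_inv_f)

lemma bij_inv_comp: "bij u \<Longrightarrow> inv' u \<circ> (u \<circ> x) = x"
  by (simp add: fun_eq_iff bij_is_inj)

lemma partial_products_quotients:
  "bij u \<Longrightarrow> (\<And>x. x \<in> set xs \<Longrightarrow> bij x) \<Longrightarrow> partial_products u (quotients c u xs) = xs @ [c]"
  by (induction xs arbitrary: u) (simp_all add: bij_comp_inv)

lemma comp_list_quotients:
  "bij u \<Longrightarrow> (\<And>x. x \<in> set xs \<Longrightarrow> bij x) \<Longrightarrow> u \<circ> comp_list (quotients c u xs) = c"
proof (induction xs arbitrary: u)
  case (Cons x xs)
  have "u \<circ> comp_list (quotients c u (x # xs)) = u \<circ> (inv' u \<circ> x) \<circ> comp_list (quotients c x xs)"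
    by (simp add: fun_eq_iff)
  then show ?case using Cons by (simp only: bij_comp_inv list.set_intros)
qed (simp add: bij_comp_inv)

lemma quotients_partial_products:
  assumes "bij u" "\<And>y. y \<in> set ys \<Longrightarrow> bij y" "ys \<noteq> []" "u \<circ> comp_list ys = c"
  shows "quotients c u (butlast (partial_products u ys)) = ys"
  using assms
proof (induction ys arbitrary: u)
  case (Cons y ys)
  show ?case
  proof (cases "ys = []")
    case True
    have "c = u \<circ> y" using Cons.prems(4) unfolding True comp_list_simps comp_id by (rule sym)
    then have "inv' u \<circ> c = y" using Cons.prems(1) by (simp only: bij_inv_comp)
    then show ?thesis by (simp add: True)
  next
    case False
    have b: "bij (u \<circ> y)" using Cons.prems by (intro bij_comp) auto
    have e: "u \<circ> y \<circ> comp_list ys = c" using Cons.prems(4) unfolding comp_list_simps comp_assoc .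
    have "quotients c (u \<circ> y) (butlast (partial_products (u \<circ> y) ys)) = ys"
      by (rule Cons.IH[OF b _ False e]) (simp add: Cons.prems(2))
    moreover have "partial_products (u \<circ> y) ys \<noteq> []" using False by (cases ys) auto
    ultimately show ?thesis using Cons.prems(1) by (simp add: bij_inv_comp)
  qed
qed simp

lemma alt_bij: "x \<in> carrier (alt_group N) \<Longrightarrow> bij x"
  by (auto simp: alt_group_carrier intro: permutes_bij)

lemma le3_iff: "le3 N x y \<longleftrightarrow> x \<in> carrier (alt_group N) \<and> y \<in> carrier (alt_group N) \<and> ell3 N y = ell3 N x + ell3 N (inv' x \<circ> y)"
  by (auto simp: le3_def alt_group_mult alt_group_inv_equality)

lemma ell3_triangle:
  assumes "x \<in> carrier (alt_group N)" "y \<in> carrier (alt_group N)"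
  shows "ell3 N y \<le> ell3 N x + ell3 N (inv' x \<circ> y)"
  using ell3_comp_le[of x N "inv' x \<circ> y"] assms
  by (simp add: bij_comp_inv alt_bij alt_group_inv_closed alt_group_comp_closed)

lemma quotients_in_alt_group:
  "u \<in> carrier (alt_group N) \<Longrightarrow> c \<in> carrier (alt_group N) \<Longrightarrow> set xs \<subseteq> carrier (alt_group N) \<Longrightarrow> set (quotients c u xs) \<subseteq> carrier (alt_group N)"
  by (induction xs arbitrary: u) (simp_all add: alt_group_inv_closed alt_group_comp_closed)

lemma partial_products_in_alt_group:
  "u \<in> carrier (alt_group N) \<Longrightarrow> set ys \<subseteq> carrier (alt_group N) \<Longrightarrow> set (partial_products u ys) \<subseteq> carrier (alt_group N)"
  by (induction ys arbitrary: u) (simp_all add: alt_group_comp_closed)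

lemma ell3_le_quotients:
  assumes "u \<in> carrier (alt_group N)" "c \<in> carrier (alt_group N)" "set xs \<subseteq> carrier (alt_group N)"
  shows "ell3 N (inv' u \<circ> c) \<le> sum_list (map (ell3 N) (quotients c u xs))"
proof -
  have "comp_list (quotients c u xs) = inv' u \<circ> (u \<circ> comp_list (quotients c u xs))"
    using assms by (simp only: bij_inv_comp alt_bij)
  also have "\<dots> = inv' u \<circ> c"
    using assms alt_bij by (subst comp_list_quotients) auto
  finally show ?thesis using ell3_comp_list_le[OF quotients_in_alt_group[OF assms]] by simp
qed

text \<open>The equations that define the order telescope along the chain.\<close>

lemma chain_imp_quotients:
  assumes "u \<in> carrier (alt_group N)" "c \<in> carrier (alt_group N)" "set xs \<subseteq> carrier (alt_group N)" "successively (le3 N) (u # xs)" "le3 N (last (u # xs)) c"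
  shows "ell3 N u + sum_list (map (ell3 N) (quotients c u xs)) = ell3 N c"
  using assms
proof (induction xs arbitrary: u)
  case (Cons x xs)
  have "ell3 N x + sum_list (map (ell3 N) (quotients c x xs)) = ell3 N c"
    using Cons.prems by (intro Cons.IH) auto
  moreover have "ell3 N x = ell3 N u + ell3 N (inv' u \<circ> x)"
    using Cons.prems by (simp add: le3_iff)
  ultimately show ?case by simp
qed (simp add: le3_iff)

text \<open>The bound leaves no slack in any triangle inequality, so all of them are equalities. It
  is an upper bound because only this is at hand for the tail before \<open>le3 N u x\<close> is
  known.\<close>

lemma quotients_imp_chain:
  assumes "u \<in> carrier (alt_group N)" "c \<in> carrier (alt_group N)" "set xs \<subseteq> carrier (alt_group N)" "ell3 N u + sum_list (map (ell3 N) (quotients c u xs)) \<le> ell3 N c"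
  shows "successively (le3 N) (u # xs) \<and> (\<forall>x\<in>set (u # xs). le3 N x c)"
  using assms
proof (induction xs arbitrary: u)
  case Nil
  then show ?case using ell3_triangle[of u N c] by (simp add: le3_iff)
next
  case (Cons x xs)
  have x: "x \<in> carrier (alt_group N)" and xs: "set xs \<subseteq> carrier (alt_group N)" using Cons.prems by auto
  let ?s = "sum_list (map (ell3 N) (quotients c x xs))"
  have sum: "ell3 N u + (ell3 N (inv' u \<circ> x) + ?s) \<le> ell3 N c" using Cons.prems(4) by simp
  have ux: "ell3 N x \<le> ell3 N u + ell3 N (inv' u \<circ> x)" using Cons.prems(1) x by (rule ell3_triangle)
  have IH: "successively (le3 N) (x # xs) \<and> (\<forall>z\<in>set (x # xs). le3 N z c)"
    using Cons.prems x xs sum ux by (intro Cons.IH) auto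
  have "ell3 N c \<le> ell3 N x + ?s"
    using ell3_triangle[OF x Cons.prems(2)] ell3_le_quotients[OF x Cons.prems(2) xs] by linarith
  then have "le3 N u x" using Cons.prems(1) x sum ux by (simp add: le3_iff)
  moreover have "le3 N u c"
    using ell3_le_quotients[OF Cons.prems(1-3)] ell3_triangle[OF Cons.prems(1,2)] Cons.prems(1,2,4)
    by (simp add: le3_iff)
  ultimately show ?case using IH by simp
qed

text \<open>With the identity and \<open>c\<close> adjoined at its ends, a chain of
  \<open>q - 1\<close> entries has \<open>q\<close> successive quotients.\<close>

lemma card_multichains_eq_card_factorisations:
  assumes c: "c \<in> carrier (alt_group N)" and q: "1 \<le> q"
  shows "card (multichains (le3 N) (interval3 N \<one>\<^bsub>alt_group N\<^esub> c) (q - 1)) =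
    card {ys. length ys = q \<and> set ys \<subseteq> carrier (alt_group N) \<and> comp_list ys = c \<and>
      sum_list (map (ell3 N) ys) = ell3 N c}" (is "card ?M = card ?F")
proof (rule bij_betw_same_card)
  have id_le: "le3 N id x" if "x \<in> carrier (alt_group N)" for x
    using that by (simp add: le3_iff id_in_alt_group ell3_id)
  have I: "interval3 N \<one>\<^bsub>alt_group N\<^esub> c = {x \<in> carrier (alt_group N). le3 N x c}"
    using id_le by (auto simp: interval3_def alt_group_one)
  show "bij_betw (quotients c id) ?M ?F"
  proof (rule bij_betw_byWitness[where f' = "\<lambda>ys. butlast (partial_products id ys)"])
    show "\<forall>xs\<in>?M. butlast (partial_products id (quotients c id xs)) = xs"
    proof
      fix xs assume "xs \<in> ?M"
      then have "bij x" if "x \<in> set xs" for x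
        using that alt_bij[of x N] by (auto simp: multichains_def I)
      then have "partial_products id (quotients c id xs) = xs @ [c]"
        by (rule partial_products_quotients[OF bij_id])
      then show "butlast (partial_products id (quotients c id xs)) = xs" by simp
    qed
    show "\<forall>ys\<in>?F. quotients c id (butlast (partial_products id ys)) = ys"
    proof
      fix ys assume ys: "ys \<in> ?F"
      then have "bij y" if "y \<in> set ys" for y using that alt_bij[of y N] by auto
      then show "quotients c id (butlast (partial_products id ys)) = ys"
        using ys q by (intro quotients_partial_products[OF bij_id]) auto
    qed
    show "quotients c id ` ?M \<subseteq> ?F"
    proof (rule image_subsetI)
      fix xs assume "xs \<in> ?M"
      then have len: "length xs = q - 1" and xs: "set xs \<subseteq> carrier (alt_group N)" and le: "\<forall>x\<in>set xs. le3 N x c"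
        and suc: "successively (le3 N) xs"
        by (auto simp: multichains_def I)
      have "successively (le3 N) (id # xs)" using suc id_le xs by (cases xs) auto
      moreover have "le3 N (last (id # xs)) c" using le id_le[OF c] by simp
      ultimately have "ell3 N id + sum_list (map (ell3 N) (quotients c id xs)) = ell3 N c"
        using xs c id_in_alt_group by (intro chain_imp_quotients)
      moreover have "id \<circ> comp_list (quotients c id xs) = c"
        using xs alt_bij[of _ N] by (intro comp_list_quotients[OF bij_id]) blast
      ultimately show "quotients c id xs \<in> ?F"
        using quotients_in_alt_group[OF id_in_alt_group c xs] len q by (simp add: ell3_id)
    qed
    show "(\<lambda>ys. butlast (partial_products id ys)) ` ?F \<subseteq> ?M"
    proof (rule image_subsetI)
      fix ys assume "ys \<in> ?F"
      then have len: "length ys = q" and ys: "set ys \<subseteq> carrier (alt_group N)" and cl: "comp_list ys = c"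
        and sum: "sum_list (map (ell3 N) ys) = ell3 N c" by auto
      let ?xs = "butlast (partial_products id ys)"
      have "quotients c id ?xs = ys"
        using alt_bij[of _ N] ys q len cl by (intro quotients_partial_products[OF bij_id]) auto
      moreover have xs: "set ?xs \<subseteq> carrier (alt_group N)"
        using partial_products_in_alt_group[OF id_in_alt_group ys] by (auto dest: in_set_butlastD)
      ultimately have "successively (le3 N) (id # ?xs) \<and> (\<forall>x\<in>set (id # ?xs). le3 N x c)"
        using sum c id_in_alt_group by (intro quotients_imp_chain) (auto simp: ell3_id)
      then show "?xs \<in> ?M"
        using xs len by (auto simp: multichains_def I successively_Cons)
    qed
  qed
qed

text \<open>Links the cycle of the theorem to the interval form: \<open>Suc k\<close> sits at
  position \<open>k\<close> of the list, and rotating the list once wraps positions modulo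
  \<open>N\<close>.\<close>

lemma cycle_of_list_upt: "cycle_of_list [1..<N + 1] = rot 1 (N + 1)"
proof
  fix z
  let ?cs = "[1..<N + 1]"
  show "cycle_of_list ?cs z = rot 1 (N + 1) z"
  proof (cases "z \<in> {1..<N + 1}")
    case True
    define k where "k = z - 1"
    have k: "k < N" and z: "z = Suc k" using True by (auto simp: k_def)
    have "map (cycle_of_list ?cs) ?cs = rotate1 ?cs"
      using cyclic_rotation[of ?cs 1] by simp
    then have "map (cycle_of_list ?cs) ?cs ! k = rotate1 ?cs ! k" by simp
    then have "cycle_of_list ?cs (?cs ! k) = ?cs ! (Suc k mod N)"
      using k by (simp add: nth_rotate1 del: upt_Suc)
    moreover have "?cs ! k = z" using k by (simp add: z del: upt_Suc)
    moreover have "?cs ! (Suc k mod N) = Suc (Suc k mod N)" using k by (simp del: upt_Suc)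
    ultimately have "cycle_of_list ?cs z = Suc (Suc k mod N)" by simp
    also have "\<dots> = rot 1 (N + 1) z" using k by (auto simp: rot_def z mod_Suc)
    finally show ?thesis .
  next
    case False
    then have "z \<notin> set ?cs" by auto
    then show ?thesis using False by (auto simp: id_outside_supp rot_def simp del: upt_Suc)
  qed
qed

lemma odd_cycles_rot:
  assumes "l < h" "odd (h - l)"
  shows "odd_cycles (rot l h)"
  unfolding odd_cycles_def
proof
  fix z
  show "odd (card (orbit (rot l h) z))"
  proof (cases "z \<in> {l..<h}")
    case True
    then show ?thesis using assms by (simp add: orbit_rot)
  next
    case False
    then have "rot l h z = z" by (auto simp: rot_def)
    then have "orbit (rot l h) z = {z}" by (simp add: orbit_eq_singleton_iff)
    then show ?thesis by simp
  qed
qed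

theorem theorem1p1:
  fixes n N q :: nat and c :: "nat \<Rightarrow> nat"
  assumes "n \<ge> 1"
    and "N = 2 * n + 1"
    and "c = cycle_of_list [1..<N + 1]"
    and "q \<ge> 1"
  shows "real (zeta_value (le3 N) (interval3 N \<one>\<^bsub>alt_group N\<^esub> c) q) =
    real q / (real q * (2 * real n + 1) - real n) * real ((q * (2 * n + 1) - n) choose n)"
proof -
  have c: "c = rot 1 (N + 1)" using assms(3) cycle_of_list_upt by simp
  have S: "{1..<N + 1} = {1..N}" by auto
  have perm: "c permutes {1..N}" unfolding c using rot_permutes[of 1 "N + 1"] by (simp only: S)
  \<comment> \<open>The cycle has size \<open>N = 2 * n + 1\<close>; this is where its oddness
    enters.\<close>
  have odd: "odd_cycles c" unfolding c using assms(2) by (intro odd_cycles_rot) auto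
  have "zeta_value (le3 N) (interval3 N \<one>\<^bsub>alt_group N\<^esub> c) q = card (min_fact q {1..N} c)"
    unfolding zeta_value_def
      card_multichains_eq_card_factorisations[OF ell3_odd_cycles(1)[OF perm odd] assms(4)]
      ell3_factorisations_eq_min_fact[OF perm odd] ..
  \<comment> \<open>With \<open>i = 0\<close> no factor is constrained at the base point.\<close>
  also have "\<dots> = cyc_count q 0 (2 * n + 1)"
    using card_min_fact_rot[of 1 "N + 1" 0 q] unfolding c S by (simp add: assms(2))
  finally have "real (zeta_value (le3 N) (interval3 N \<one>\<^bsub>alt_group N\<^esub> c) q) =
      real q / real (n * (2 * q - 1) + q) * real ((n * (2 * q - 1) + q) choose n)"
    using cyc_count_odd[OF assms(4), of n] by simp
  moreover have eq: "n * (2 * q - 1) + q = q * (2 * n + 1) - n"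
    using assms(4) by (simp add: algebra_simps)
  \<comment> \<open>Since \<open>n \<le> q * (2 * n + 1)\<close>, subtraction on the natural numbers
    agrees with that on the reals.\<close>
  moreover have "real (q * (2 * n + 1) - n) = real q * (2 * real n + 1) - real n"
  proof -
    have "n \<le> q * (2 * n + 1)" using assms(4) by (metis le_add1 le_trans mult_2 mult_le_mono nat_mult_1 add.assoc)
    then show ?thesis by (simp add: of_nat_diff algebra_simps)
  qed
  ultimately show ?thesis by (simp only:)
qed

end
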